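(* Assume $(\mathcal A_1)$ holds for some $1<i<n$, with $u=u_l\in\mathcal V$. Let $(u_l,u_r,\sigma_{l,r})$ be an $i$-th entropic shock with $u_r=S^i_{u_l}(s_0)$, $\sigma_{l,r}=\sigma_{u_l}(s_0)$ for some $s_0>0$. (1) Let $0<a<1$. Assume there is $j<i$ and a backward $j$-rarefaction curve $R^{j,-}_{u_l}$ issued from $u_l$ which intersects $\Sigma_a$ (i.e. $R^{j,-}_{u_l}(\bar s)\in\Sigma_a$ for some $\bar s>0$). Then $(u_l,u_r,\sigma_{l,r})$ does not satisfy $a$-contraction. (2) Let $a>1$. Assume there is $k>i$ and a forward $k$-rarefaction curve $R^{k,+}_{u_r}$ issued from $u_r$ which intersects $\Sigma_a$. Then $(u_l,u_r,\sigma_{l,r})$ does not satisfy $a$-contraction. (3) Let $a=1$ and assume the hypothesis (on the curve) of (1) or of (2) holds. Then $(u_l,u_r,\sigma_{l,r})$ does not satisfy $a$-contraction.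
   Context: Framework. System $\partial_t u+\partial_x f(u)=0$ with $f$, strictly convex entropy $\eta$, entropy flux $q$ of class $C^2$ on an open convex $\mathcal V\subset\mathbb R^n$, $\nabla q=\nabla\eta\,\nabla f$; $\mathcal U$ = limits of sequences in $\mathcal V$ with bounded $\eta$, $\eta$ extended by lower limits. $\eta(u|v)=\eta(u)-\eta(v)-\nabla\eta(v)\cdot(u-v)$, $q(u;v)=q(u)-q(v)-\nabla\eta(v)\cdot(f(u)-f(v))$. Entropy solution: weak solution with $\partial_t\eta(u)+\partial_xq(u)\le0$. Entropic discontinuity $(u_-,u_+,\sigma)$, $u_-\neq u_+$: $f(u_+)-f(u_-)=\sigma(u_+-u_-)$, $q(u_+)-q(u_-)\le\sigma(\eta(u_+)-\eta(u_-))$. $\lambda_1(u)\le\dots\le\lambda_n(u)$ are the eigenvalues of $\nabla f(u)$ with right eigenvectors $r_1(u),\dots,r_n(u)$; the $m$-th field is genuinely nonlinear if $\nabla\lambda_m\cdot r_m\neq0$. Hypothesis $(\mathcal A_1)$: for some $1<i<n$ the $i$-th field is genuinely nonlinear on $\mathcal U$; for the given $u\in\mathcal V$ there is a $C^1$ curve $S^i_u:[0,s_u)\to\mathcal U$ with $S^i_u(0)=u$ and a $C^1$ speed $\sigma_u$ with $f(S^i_u(s))-f(u)=\sigma_u(s)(S^i_u(s)-u)$, $\sigma_u'(s)<0$, $\sigma_u(0)=\lambda_i(u)$; moreover the extended Lax condition holds: $\lambda_{m-1}(u_-)\le\sigma\le\lambda_{m+1}(u_+)$ for every $m$-th shock $(u_-,u_+,\sigma)$.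 $\Sigma_a=\{u:\eta(u|u_l)=a\eta(u|u_r)\}$. A backward $j$-rarefaction curve issued from $u_l$ is a $C^1$ curve $s\mapsto R^{j,-}_{u_l}(s)\in\mathcal V$, $s\ge0$, with $R^{j,-}_{u_l}(0)=u_l$, $\frac{d}{ds}R^{j,-}_{u_l}(s)=r_j(R^{j,-}_{u_l}(s))$, $\nabla\lambda_j\cdot r_j\neq0$ along it, and $\lambda_j(R^{j,-}_{u_l}(s))<\lambda_j(u_l)$ for $s>0$. A forward $k$-rarefaction curve issued from $u_r$ is defined likewise with $R^{k,+}_{u_r}(0)=u_r$, tangent $r_k$, and $\lambda_k(R^{k,+}_{u_r}(s))>\lambda_k(u_r)$ for $s>0$. a-contraction. $E_a(u(t),h)=\int_{-\infty}^h\eta(u(t,x)|u_l)dx+a\int_h^\infty\eta(u(t,x)|u_r)dx$, $S(x)=u_l$ for $x<0$, $u_r$ for $x>0$. $(u_l,u_r,\sigma_{l,r})$ satisfies $a$-contraction if for every bounded convex $\mathcal U_K\subset\mathcal U$ there is $C_K$ such that for every entropy weak solution $u\in\mathcal U_K\cap BV_{loc}((0,T)\times\mathbb R)^n$ with initial datum $u_0$, $E_a(u_0,0)<\infty$, there is a Lipschitz $h$, $h(0)=0$, with $E_a(u(t),h(t))\le E_a(u(s),h(s))$ for a.e. $t>s>0$, $|h'(t)|\le C_K$, $|h(t)-\sigma_{l,r}t|\le C_K\sqrt t\|u_0-S\|_{L^2}$. *)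

theory Defs
  imports "HOL-Analysis.Analysis"
begin

definition strictly_convex_on :: "('a::real_vector) set \<Rightarrow> ('a \<Rightarrow> real) \<Rightarrow> bool" where
  "strictly_convex_on V g \<longleftrightarrow>
     (\<forall>x\<in>V. \<forall>y\<in>V. \<forall>t::real. x \<noteq> y \<and> 0 < t \<and> t < 1 \<longrightarrow>
        g (t *\<^sub>R x + (1 - t) *\<^sub>R y) < t * g x + (1 - t) * g y)"

definition C2_on :: "('a::euclidean_space) set \<Rightarrow> ('a \<Rightarrow> 'b::real_normed_vector) \<Rightarrow> bool" where
  "C2_on V g \<longleftrightarrow> (\<exists>(Dg::'a \<Rightarrow> 'a \<Rightarrow>\<^sub>L 'b) (D2g::'a \<Rightarrow> 'a \<Rightarrow>\<^sub>L ('a \<Rightarrow>\<^sub>L 'b)).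
      (\<forall>u\<in>V. (g has_derivative blinfun_apply (Dg u)) (at u)) \<and>
      (\<forall>u\<in>V. (Dg has_derivative blinfun_apply (D2g u)) (at u)) \<and>
      continuous_on V D2g)"

definition Ucl :: "('a::real_normed_vector) set \<Rightarrow> ('a \<Rightarrow> real) \<Rightarrow> 'a set" where
  "Ucl V eta = {u. \<exists>X. (\<forall>k. X k \<in> V) \<and> X \<longlonglongrightarrow> u \<and> bounded (range (\<lambda>k. eta (X k)))}"

definition rel_eta :: "('a::real_inner \<Rightarrow> real) \<Rightarrow> ('a \<Rightarrow> 'a) \<Rightarrow> 'a \<Rightarrow> 'a \<Rightarrow> real" where
  "rel_eta eta Deta u v = eta u - eta v - Deta v \<bullet> (u - v)"

definition Sigma_a :: "('a::real_inner \<Rightarrow> real) \<Rightarrow> ('a \<Rightarrow> 'a) \<Rightarrow> real \<Rightarrow> 'a \<Rightarrow> 'a \<Rightarrow> 'a set" where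
  "Sigma_a eta Deta a ul ur = {u. rel_eta eta Deta u ul = a * rel_eta eta Deta u ur}"

definition framework ::
  "(real^'n) set \<Rightarrow> (real^'n \<Rightarrow> real^'n) \<Rightarrow> (real^'n \<Rightarrow> real) \<Rightarrow> (real^'n \<Rightarrow> real)
   \<Rightarrow> (real^'n \<Rightarrow> real^'n) \<Rightarrow> (real^'n \<Rightarrow> (real^'n) \<Rightarrow>\<^sub>L (real^'n))
   \<Rightarrow> (nat \<Rightarrow> real^'n \<Rightarrow> real) \<Rightarrow> (nat \<Rightarrow> real^'n \<Rightarrow> real^'n) \<Rightarrow> bool" where
  "framework V f eta q Deta Df lam r \<longleftrightarrow>
     open V \<and> convex V \<and> V \<noteq> {} \<and>
     C2_on V f \<and> C2_on V eta \<and> C2_on V q \<and>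
     (\<forall>u\<in>V. (f has_derivative blinfun_apply (Df u)) (at u)) \<and>
     (\<forall>u\<in>V. (eta has_derivative (\<lambda>h. Deta u \<bullet> h)) (at u)) \<and>
     (\<forall>u\<in>V. (q has_derivative (\<lambda>h. Deta u \<bullet> Df u h)) (at u)) \<and>
     strictly_convex_on V eta \<and>
     (\<forall>u\<in>Ucl V eta. ereal (eta u) = Liminf (at u within V) (\<lambda>v. ereal (eta v))) \<and>
     (\<forall>u\<in>V.
        (\<forall>x. det (matrix (blinfun_apply (Df u)) - x *\<^sub>R mat 1) = (\<Prod>j=1..CARD('n). (lam j u - x))) \<and>
        (\<forall>j. 1 \<le> j \<and> j < CARD('n) \<longrightarrow> lam j u \<le> lam (Suc j) u) \<and>
        (\<forall>j. 1 \<le> j \<and> j \<le> CARD('n) \<longrightarrow> r j u \<noteq> 0 \<and> Df u (r j u) = lam j u *\<^sub>R r j u))"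

definition gnl_at :: "(real^'n) set \<Rightarrow> (nat \<Rightarrow> real^'n \<Rightarrow> real) \<Rightarrow> (nat \<Rightarrow> real^'n \<Rightarrow> real^'n)
   \<Rightarrow> nat \<Rightarrow> real^'n \<Rightarrow> bool" where
  "gnl_at V lam r m u \<longleftrightarrow> (\<exists>D. (lam m has_derivative D) (at u within V) \<and> D (r m u) \<noteq> 0)"

definition entropic_disc ::
  "(real^'n \<Rightarrow> real^'n) \<Rightarrow> (real^'n \<Rightarrow> real) \<Rightarrow> (real^'n \<Rightarrow> real)
   \<Rightarrow> real^'n \<Rightarrow> real^'n \<Rightarrow> real \<Rightarrow> bool" where
  "entropic_disc f eta q um up \<sigma> \<longleftrightarrow>
     um \<noteq> up \<and> f up - f um = \<sigma> *\<^sub>R (up - um) \<and> q up - q um \<le> \<sigma> * (eta up - eta um)"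

definition mth_shock ::
  "(real^'n \<Rightarrow> real^'n) \<Rightarrow> (real^'n \<Rightarrow> real) \<Rightarrow> (real^'n \<Rightarrow> real) \<Rightarrow> (nat \<Rightarrow> real^'n \<Rightarrow> real)
   \<Rightarrow> nat \<Rightarrow> real^'n \<Rightarrow> real^'n \<Rightarrow> real \<Rightarrow> bool" where
  "mth_shock f eta q lam m um up \<sigma> \<longleftrightarrow>
     entropic_disc f eta q um up \<sigma> \<and> lam m up < \<sigma> \<and> \<sigma> < lam m um"

definition hypA1 ::
  "(real^'n) set \<Rightarrow> (real^'n \<Rightarrow> real^'n) \<Rightarrow> (real^'n \<Rightarrow> real) \<Rightarrow> (real^'n \<Rightarrow> real)
   \<Rightarrow> (nat \<Rightarrow> real^'n \<Rightarrow> real) \<Rightarrow> (nat \<Rightarrow> real^'n \<Rightarrow> real^'n)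
   \<Rightarrow> nat \<Rightarrow> real^'n \<Rightarrow> (real \<Rightarrow> real^'n) \<Rightarrow> (real \<Rightarrow> real) \<Rightarrow> ereal \<Rightarrow> bool" where
  "hypA1 V f eta q lam r i u S sig su \<longleftrightarrow>
     1 < i \<and> i < CARD('n) \<and>
     (\<forall>w\<in>Ucl V eta. gnl_at V lam r i w) \<and>
     u \<in> V \<and> 0 < su \<and>
     (let I = {s::real. 0 \<le> s \<and> ereal s < su} in
       (\<exists>S'. (\<forall>s\<in>I. (S has_vector_derivative S' s) (at s within I)) \<and> continuous_on I S') \<and>
       (\<exists>sig'. (\<forall>s\<in>I. (sig has_real_derivative sig' s) (at s within I)) \<and> continuous_on I sig'
              \<and> (\<forall>s\<in>I. sig' s < 0)) \<and>
       S 0 = u \<and> (\<forall>s\<in>I. S s \<in> Ucl V eta) \<and>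
       (\<forall>s\<in>I. f (S s) - f u = sig s *\<^sub>R (S s - u)) \<and>
       sig 0 = lam i u) \<and>
     (\<forall>m um up \<sigma>. 1 \<le> m \<and> m \<le> CARD('n) \<and> um \<in> Ucl V eta \<and> up \<in> Ucl V eta \<and>
        mth_shock f eta q lam m um up \<sigma> \<longrightarrow>
        (2 \<le> m \<longrightarrow> lam (m - 1) um \<le> \<sigma>) \<and> (m + 1 \<le> CARD('n) \<longrightarrow> \<sigma> \<le> lam (m + 1) up))"

definition rarefaction_curve ::
  "(real^'n) set \<Rightarrow> (nat \<Rightarrow> real^'n \<Rightarrow> real) \<Rightarrow> (nat \<Rightarrow> real^'n \<Rightarrow> real^'n)
   \<Rightarrow> nat \<Rightarrow> real^'n \<Rightarrow> (real \<Rightarrow> real^'n) \<Rightarrow> bool" where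
  "rarefaction_curve V lam r j u0 R \<longleftrightarrow>
     R 0 = u0 \<and> (\<forall>s\<ge>0. R s \<in> V) \<and>
     (\<forall>s\<ge>0. (R has_vector_derivative r j (R s)) (at s within {0..})) \<and>
     continuous_on {0..} (\<lambda>s. r j (R s)) \<and>
     (\<forall>s\<ge>0. gnl_at V lam r j (R s))"

definition backward_rarefaction where
  "backward_rarefaction V lam r j ul R \<longleftrightarrow>
     rarefaction_curve V lam r j ul R \<and> (\<forall>s>0. lam j (R s) < lam j ul)"

definition forward_rarefaction where
  "forward_rarefaction V lam r k ur R \<longleftrightarrow>
     rarefaction_curve V lam r k ur R \<and> (\<forall>s>0. lam k (R s) > lam k ur)"

definition tsupp :: "(real \<times> real \<Rightarrow> real) \<Rightarrow> (real \<times> real) set" where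
  "tsupp \<phi> = closure {z. \<phi> z \<noteq> 0}"

definition C1c :: "(real \<times> real \<Rightarrow> real) \<Rightarrow> bool" where
  "C1c \<phi> \<longleftrightarrow> (\<exists>D::real \<times> real \<Rightarrow> (real \<times> real) \<Rightarrow>\<^sub>L real.
       (\<forall>z. (\<phi> has_derivative blinfun_apply (D z)) (at z)) \<and> continuous_on UNIV D)
     \<and> compact (tsupp \<phi>)"

definition dt :: "(real \<times> real \<Rightarrow> real) \<Rightarrow> real \<times> real \<Rightarrow> real" where
  "dt \<phi> z = frechet_derivative \<phi> (at z) (1, 0)"

definition dx :: "(real \<times> real \<Rightarrow> real) \<Rightarrow> real \<times> real \<Rightarrow> real" where
  "dx \<phi> z = frechet_derivative \<phi> (at z) (0, 1)"

abbreviation strip :: "real \<Rightarrow> (real \<times> real) set" where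
  "strip T \<equiv> {0<..<T} \<times> (UNIV::real set)"

definition weak_solution ::
  "(real^'n \<Rightarrow> real^'n) \<Rightarrow> real \<Rightarrow> (real \<times> real \<Rightarrow> real^'n) \<Rightarrow> (real \<Rightarrow> real^'n) \<Rightarrow> bool" where
  "weak_solution f T u u0 \<longleftrightarrow>
     u \<in> borel_measurable lborel \<and>
     (\<forall>\<phi>. C1c \<phi> \<and> tsupp \<phi> \<subseteq> {z. fst z < T} \<longrightarrow>
        integrable lborel (\<lambda>z. indicator (strip T) z *\<^sub>R (dt \<phi> z *\<^sub>R u z + dx \<phi> z *\<^sub>R f (u z))) \<and>
        integrable lborel (\<lambda>x. \<phi> (0, x) *\<^sub>R u0 x) \<and>
        (\<integral>z. indicator (strip T) z *\<^sub>R (dt \<phi> z *\<^sub>R u z + dx \<phi> z *\<^sub>R f (u z)) \<partial>lborel)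
          + (\<integral>x. \<phi> (0, x) *\<^sub>R u0 x \<partial>lborel) = 0)"

definition entropy_solution ::
  "(real^'n \<Rightarrow> real^'n) \<Rightarrow> (real^'n \<Rightarrow> real) \<Rightarrow> (real^'n \<Rightarrow> real)
   \<Rightarrow> real \<Rightarrow> (real \<times> real \<Rightarrow> real^'n) \<Rightarrow> (real \<Rightarrow> real^'n) \<Rightarrow> bool" where
  "entropy_solution f eta q T u u0 \<longleftrightarrow>
     weak_solution f T u u0 \<and>
     (\<forall>\<phi>. C1c \<phi> \<and> tsupp \<phi> \<subseteq> strip T \<and> (\<forall>z. 0 \<le> \<phi> z) \<longrightarrow>
        integrable lborel (\<lambda>z. indicator (strip T) z * (dt \<phi> z * eta (u z) + dx \<phi> z * q (u z))) \<and>
        0 \<le> (\<integral>z. indicator (strip T) z * (dt \<phi> z * eta (u z) + dx \<phi> z * q (u z)) \<partial>lborel))"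

definition BV_loc :: "(real \<times> real) set \<Rightarrow> (real \<times> real \<Rightarrow> real^'n) \<Rightarrow> bool" where
  "BV_loc \<Omega> u \<longleftrightarrow>
     (\<forall>W. open W \<and> compact (closure W) \<and> closure W \<subseteq> \<Omega> \<longrightarrow>
        set_integrable lborel W u \<and>
        (\<forall>j. \<exists>M. \<forall>\<phi>1 \<phi>2. C1c \<phi>1 \<and> C1c \<phi>2 \<and> tsupp \<phi>1 \<subseteq> W \<and> tsupp \<phi>2 \<subseteq> W \<and>
            (\<forall>z. (\<phi>1 z)\<^sup>2 + (\<phi>2 z)\<^sup>2 \<le> 1) \<longrightarrow>
            (\<integral>z. indicator W z * (u z $ j) * (dt \<phi>1 z + dx \<phi>2 z) \<partial>lborel) \<le> M))"

definition E_a ::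
  "(real^'n \<Rightarrow> real) \<Rightarrow> (real^'n \<Rightarrow> real^'n) \<Rightarrow> real \<Rightarrow> real^'n \<Rightarrow> real^'n
   \<Rightarrow> (real \<Rightarrow> real^'n) \<Rightarrow> real \<Rightarrow> ennreal" where
  "E_a eta Deta a ul ur w h =
     (\<integral>\<^sup>+x. indicator {..h} x * ennreal (rel_eta eta Deta (w x) ul) \<partial>lborel)
     + ennreal a * (\<integral>\<^sup>+x. indicator {h..} x * ennreal (rel_eta eta Deta (w x) ur) \<partial>lborel)"

definition riemann_step :: "real^'n \<Rightarrow> real^'n \<Rightarrow> real \<Rightarrow> real^'n" where
  "riemann_step ul ur x = (if x < 0 then ul else ur)"

definition L2sq :: "(real \<Rightarrow> real^'n) \<Rightarrow> (real \<Rightarrow> real^'n) \<Rightarrow> ennreal" where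
  "L2sq w v = (\<integral>\<^sup>+x. ennreal ((norm (w x - v x))\<^sup>2) \<partial>lborel)"

definition a_contraction ::
  "(real^'n) set \<Rightarrow> (real^'n \<Rightarrow> real^'n) \<Rightarrow> (real^'n \<Rightarrow> real) \<Rightarrow> (real^'n \<Rightarrow> real)
   \<Rightarrow> (real^'n \<Rightarrow> real^'n) \<Rightarrow> real \<Rightarrow> real^'n \<Rightarrow> real^'n \<Rightarrow> real \<Rightarrow> bool" where
  "a_contraction V f eta q Deta a ul ur \<sigma> \<longleftrightarrow>
     (\<forall>UK. UK \<subseteq> Ucl V eta \<and> bounded UK \<and> convex UK \<longrightarrow>
       (\<exists>C>0. \<forall>T>0. \<forall>u u0.
          (\<forall>z\<in>strip T. u z \<in> UK) \<and> BV_loc (strip T) u \<and>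
          entropy_solution f eta q T u u0 \<and>
          E_a eta Deta a ul ur u0 0 < \<infinity> \<longrightarrow>
          (\<exists>h::real \<Rightarrow> real. h 0 = 0 \<and> C-lipschitz_on {0..<T} h \<and>
             (\<exists>N. N \<in> null_sets lborel \<and>
                (\<forall>s t. s \<notin> N \<and> t \<notin> N \<and> 0 < s \<and> s < t \<and> t < T \<longrightarrow>
                   E_a eta Deta a ul ur (\<lambda>x. u (t, x)) (h t)
                     \<le> E_a eta Deta a ul ur (\<lambda>x. u (s, x)) (h s))) \<and>
             (\<forall>t\<in>{0..<T}. ennreal ((h t - \<sigma> * t)\<^sup>2)
                  \<le> ennreal (C\<^sup>2 * t) * L2sq u0 (riemann_step ul ur)))))"

end

theory Submission
  imports Defs
begin

text \<open>
  Write p for the end state from which the rarefaction curve R starts and w for the other end state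
  of the shock. Let v = R b be the first point of the curve on \<open>\<Sigma>\<^sub>a\<close>. An explicit entropy solution
  defeats every shift h: read from the side of p to the side of w, it consists of
  p, a compression wave from p to v along R which has not yet focused, a wide region with state v
  around the origin, a rarefaction wave from v back to p, and the shock from p to w; by the extended
  Lax condition the shock outruns the rarefaction. Since h is Lipschitz with h(0) = 0 it
  stays in the region of v, where the weighted energies of both sides agree, so the total energy is
  independent of h and affine in t. Its slope is the integral over the fan of
  \<open>a \<eta>(\<cdot>|u\<^sub>r) - \<eta>(\<cdot>|u\<^sub>l)\<close> (up to the sign given by the direction) plus a nonnegative multiple of the speed gap
  between shock and fan, hence positive.

  Weak formulation, entropy inequality and BV bound need no regularity of the inverse of the speed
  along R: R and its images under f, \<open>\<eta>\<close>, q are integrals over s of their derivatives, so the fans are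
  superpositions of steps travelling with constant speed, and Fubini reduces everything to one step.
\<close>

section \<open>Test functions and transport along lines\<close>

text \<open>The constant C of the contraction may depend on the set of values but not on the
  solution. This decides the order of choices: the states form a fixed compact set, C is read off
  from its convex hull, and only then does C become the half-width of the plateau at v, with time
  horizon 1. Finite energy asks for p and w at the two ends, so v must be reached from p and left
  again; as the speed decreases along R, the way to v is a compression and the way back a
  rarefaction. The extent of the compression is proportional to 2 - t and is charged with the
  entropy relative to p; that of the rarefaction is proportional to t + 1 and is charged with the
  entropy relative to w. Between p and v the weighted entropy relative to w is the larger one, so
  this exchange is a strict gain. Both edges of the plateau move with the speed of v, so its width
  is constant. The sign e is the direction from p to w; in the variable e x the backward and the
  forward case are one proof.\<close>

lemma C1c_derivative:
  assumes "C1c \<phi>"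
  obtains D :: "real \<times> real \<Rightarrow> (real \<times> real) \<Rightarrow>\<^sub>L real"
    where "\<And>z. (\<phi> has_derivative blinfun_apply (D z)) (at z)" "continuous_on UNIV D"
      "\<And>z. dt \<phi> z = D z (1, 0)" "\<And>z. dx \<phi> z = D z (0, 1)"
proof -
  obtain D :: "real \<times> real \<Rightarrow> (real \<times> real) \<Rightarrow>\<^sub>L real"
    where D: "\<And>z. (\<phi> has_derivative blinfun_apply (D z)) (at z)" "continuous_on UNIV D"
    using assms unfolding C1c_def by blast
  have "frechet_derivative \<phi> (at z) = blinfun_apply (D z)" for z
    using frechet_derivative_at[OF D(1)] by simp
  then show ?thesis
    by (intro that[OF D]) (simp_all add: dt_def dx_def)
qed

lemma C1c_continuous:
  assumes "C1c \<phi>"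
  shows "continuous_on UNIV \<phi>" "continuous_on UNIV (dt \<phi>)" "continuous_on UNIV (dx \<phi>)"
proof -
  obtain D :: "real \<times> real \<Rightarrow> (real \<times> real) \<Rightarrow>\<^sub>L real"
    where D: "\<And>z. (\<phi> has_derivative blinfun_apply (D z)) (at z)" "continuous_on UNIV D"
      "\<And>z. dt \<phi> z = D z (1, 0)" "\<And>z. dx \<phi> z = D z (0, 1)"
    using C1c_derivative[OF assms] by blast
  show "continuous_on UNIV \<phi>"
    by (rule has_derivative_continuous_on[OF has_derivative_at_withinI[OF D(1)]])
  have "dt \<phi> = (\<lambda>z. D z (1, 0))" "dx \<phi> = (\<lambda>z. D z (0, 1))"
    using D(3,4) by auto
  then show "continuous_on UNIV (dt \<phi>)" "continuous_on UNIV (dx \<phi>)"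
    using blinfun.continuous_on[OF D(2) continuous_on_const] by auto
qed

lemma C1c_measurable [measurable_dest]:
  assumes "C1c \<phi>"
  shows "\<phi> \<in> borel_measurable borel" "dt \<phi> \<in> borel_measurable borel" "dx \<phi> \<in> borel_measurable borel"
  using C1c_continuous[OF assms] by (auto intro: borel_measurable_continuous_onI)

lemma C1c_DERIV_line:
  assumes "C1c \<phi>"
  shows "((\<lambda>t. \<phi> (t, y + m * t)) has_real_derivative
           dt \<phi> (t, y + m * t) + m * dx \<phi> (t, y + m * t)) (at t)"
proof -
  obtain D :: "real \<times> real \<Rightarrow> (real \<times> real) \<Rightarrow>\<^sub>L real"
    where D: "\<And>z. (\<phi> has_derivative blinfun_apply (D z)) (at z)" "continuous_on UNIV D"
      "\<And>z. dt \<phi> z = D z (1, 0)" "\<And>z. dx \<phi> z = D z (0, 1)"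
    using C1c_derivative[OF assms] by blast
  have "((\<lambda>t. (t, y + m * t)) has_derivative (\<lambda>h. (h, m * h))) (at t)"
    by (auto intro!: derivative_eq_intros)
  from has_derivative_compose[OF this D(1)]
  have 1: "((\<lambda>t. \<phi> (t, y + m * t)) has_derivative (\<lambda>h. D (t, y + m * t) (h, m * h))) (at t)" .
  have "D (t, y + m * t) (h, m * h) = (dt \<phi> (t, y + m * t) + m * dx \<phi> (t, y + m * t)) * h" for h
  proof -
    have "(h, m * h) = h *\<^sub>R (1, 0) + (m * h) *\<^sub>R (0, 1::real)"
      by simp
    then show ?thesis
      unfolding D(3,4) by (simp only: blinfun.add_right blinfun.scaleR_right) (simp add: algebra_simps)
  qed
  with 1 show ?thesis
    by (simp add: has_field_derivative_def)
qed

lemma C1c_DERIV_dx: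
  assumes "C1c \<phi>"
  shows "((\<lambda>x. \<phi> (t, x)) has_real_derivative dx \<phi> (t, x)) (at x)"
proof -
  obtain D :: "real \<times> real \<Rightarrow> (real \<times> real) \<Rightarrow>\<^sub>L real"
    where D: "\<And>z. (\<phi> has_derivative blinfun_apply (D z)) (at z)" "continuous_on UNIV D"
      "\<And>z. dt \<phi> z = D z (1, 0)" "\<And>z. dx \<phi> z = D z (0, 1)"
    using C1c_derivative[OF assms] by blast
  have "((\<lambda>x. (t, x)) has_derivative (\<lambda>h. (0, h))) (at x)"
    by (auto intro!: derivative_eq_intros)
  from has_derivative_compose[OF this D(1)]
  have 1: "((\<lambda>x. \<phi> (t, x)) has_derivative (\<lambda>h. D (t, x) (0, h))) (at x)" .
  have "D (t, x) (0, h) = dx \<phi> (t, x) * h" for h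
  proof -
    have "(0, h) = h *\<^sub>R (0, 1::real)"
      by simp
    then show ?thesis
      unfolding D(3,4) using blinfun.scaleR_right[of "D (t, x)" h "(0, 1)"] by simp
  qed
  with 1 show ?thesis
    by (simp add: has_field_derivative_def)
qed

lemma C1c_eq_0:
  assumes "C1c \<phi>" "z \<notin> tsupp \<phi>"
  shows "\<phi> z = 0" "dt \<phi> z = 0" "dx \<phi> z = 0"
proof -
  have sub: "{z. \<phi> z \<noteq> 0} \<subseteq> tsupp \<phi>"
    unfolding tsupp_def by (rule closure_subset)
  then show "\<phi> z = 0"
    using assms(2) by blast
  have "(\<phi> has_derivative (\<lambda>_. 0)) (at z)"
  proof (rule has_derivative_transform_within_open)
    show "((\<lambda>_. 0) has_derivative (\<lambda>_. 0)) (at z)" by simp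
    show "open (- tsupp \<phi>)" by (simp add: tsupp_def open_Compl)
    show "z \<in> - tsupp \<phi>" using assms(2) by simp
    show "\<And>y. y \<in> - tsupp \<phi> \<Longrightarrow> 0 = \<phi> y" using sub by auto
  qed
  then have "frechet_derivative \<phi> (at z) = (\<lambda>_. 0)"
    by (rule frechet_derivative_at[symmetric])
  then show "dt \<phi> z = 0" "dx \<phi> z = 0"
    by (auto simp: dt_def dx_def)
qed

text \<open>One K is both the half-side of a square outside which everything vanishes and a bound
  for the function and its partial derivatives; integrability then follows by comparison.\<close>

lemma C1c_box:
  assumes "C1c \<phi>"
  obtains K where "K > 0"
    "\<And>z. z \<notin> {-K..K} \<times> {-K..K} \<Longrightarrow> \<phi> z = 0 \<and> dt \<phi> z = 0 \<and> dx \<phi> z = 0"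
    "\<And>z. \<bar>\<phi> z\<bar> \<le> K \<and> \<bar>dt \<phi> z\<bar> \<le> K \<and> \<bar>dx \<phi> z\<bar> \<le> K"
proof -
  have c: "compact (tsupp \<phi>)"
    using assms by (simp add: C1c_def)
  then obtain K1 where K1: "K1 > 0" "\<And>z. z \<in> tsupp \<phi> \<Longrightarrow> norm z \<le> K1"
    using compact_imp_bounded bounded_pos by metis
  have bd: "\<exists>K>0. \<forall>z. \<bar>\<psi> z\<bar> \<le> K" if "continuous_on UNIV \<psi>" "\<And>z. z \<notin> tsupp \<phi> \<Longrightarrow> \<psi> z = 0"
    for \<psi> :: "real \<times> real \<Rightarrow> real"
  proof -
    have "bounded (\<psi> ` tsupp \<phi>)"
      by (rule compact_imp_bounded[OF compact_continuous_image[OF continuous_on_subset[OF that(1)] c]]) simp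
    then obtain K where K: "K > 0" "\<And>z. z \<in> tsupp \<phi> \<Longrightarrow> \<bar>\<psi> z\<bar> \<le> K"
      unfolding bounded_pos by auto
    then have "\<bar>\<psi> z\<bar> \<le> K" for z
      using that(2) by (cases "z \<in> tsupp \<phi>") auto
    with K(1) show ?thesis by blast
  qed
  obtain A B C where ABC: "\<And>z. \<bar>\<phi> z\<bar> \<le> A" "\<And>z. \<bar>dt \<phi> z\<bar> \<le> B" "\<And>z. \<bar>dx \<phi> z\<bar> \<le> C"
    using bd[OF C1c_continuous(1)[OF assms] C1c_eq_0(1)[OF assms]]
      bd[OF C1c_continuous(2)[OF assms] C1c_eq_0(2)[OF assms]]
      bd[OF C1c_continuous(3)[OF assms] C1c_eq_0(3)[OF assms]] by auto
  define K where "K = Max {K1, A, B, C}"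
  have K: "K1 \<le> K" "A \<le> K" "B \<le> K" "C \<le> K"
    by (simp_all add: K_def)
  show ?thesis
  proof
    show "K > 0" using K1(1) K(1) by linarith
    show "\<phi> z = 0 \<and> dt \<phi> z = 0 \<and> dx \<phi> z = 0" if "z \<notin> {-K..K} \<times> {-K..K}" for z
    proof -
      have "z \<notin> tsupp \<phi>"
      proof
        assume "z \<in> tsupp \<phi>"
        then have "norm z \<le> K" using K1(2) K(1) by fastforce
        then have "\<bar>fst z\<bar> \<le> K" "\<bar>snd z\<bar> \<le> K"
          using norm_fst_le[of "fst z" "snd z"] norm_snd_le[of "snd z" "fst z"] by auto
        with that show False by (cases z) auto
      qed
      then show ?thesis using C1c_eq_0[OF assms] by blast
    qed
    show "\<bar>\<phi> z\<bar> \<le> K \<and> \<bar>dt \<phi> z\<bar> \<le> K \<and> \<bar>dx \<phi> z\<bar> \<le> K" for z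
      using ABC[of z] K by linarith
  qed
qed

lemma C1c_integrable:
  assumes "C1c \<phi>"
  shows "integrable lborel (dt \<phi>)" "integrable lborel (dx \<phi>)" "integrable lborel (\<lambda>x. \<phi> (t, x))"
proof -
  note [measurable] = C1c_measurable[OF assms]
  obtain K where K: "K > 0"
    "\<And>z. z \<notin> {-K..K} \<times> {-K..K} \<Longrightarrow> \<phi> z = 0 \<and> dt \<phi> z = 0 \<and> dx \<phi> z = 0"
    "\<And>z. \<bar>\<phi> z\<bar> \<le> K \<and> \<bar>dt \<phi> z\<bar> \<le> K \<and> \<bar>dx \<phi> z\<bar> \<le> K"
    using C1c_box[OF assms] by blast
  have c: "compact ({-K..K} \<times> {-K..K})"
    by (intro compact_Times) auto
  have *: "integrable lborel \<psi>" if [measurable]: "\<psi> \<in> borel_measurable borel"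
    and "\<And>z. z \<notin> {-K..K} \<times> {-K..K} \<Longrightarrow> \<psi> z = 0" and "\<And>z. \<bar>\<psi> z\<bar> \<le> K"
  for \<psi> :: "real \<times> real \<Rightarrow> real"
  proof (rule integrableI_bounded_set)
    show "{-K..K} \<times> {-K..K} \<in> sets lborel"
      using c by (simp add: borel_compact)
    show "emeasure lborel ({-K..K} \<times> {-K..K}) < \<infinity>"
      using emeasure_compact_finite[OF c] .
    show "AE z in lborel. z \<in> {-K..K} \<times> {-K..K} \<longrightarrow> norm (\<psi> z) \<le> K"
      by (rule AE_I2) (simp add: that)
    show "AE z in lborel. z \<notin> {-K..K} \<times> {-K..K} \<longrightarrow> \<psi> z = 0"
      using that(2) by (intro AE_I2 impI)
  qed simp
  show "integrable lborel (dt \<phi>)" "integrable lborel (dx \<phi>)"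
    by (rule *[OF C1c_measurable(2)[OF assms]] *[OF C1c_measurable(3)[OF assms]]; simp add: K del: mem_Times_iff)+
  show "integrable lborel (\<lambda>x. \<phi> (t, x))"
  proof (rule integrableI_bounded_set)
    show "AE x in lborel. x \<in> {-K..K} \<longrightarrow> norm (\<phi> (t, x)) \<le> K"
      by (rule AE_I2) (simp add: K)
    show "AE x in lborel. x \<notin> {-K..K} \<longrightarrow> \<phi> (t, x) = 0"
      using K(2) by (intro AE_I2 impI) blast
    show "emeasure lborel {-K..K} < \<infinity>"
      by (rule emeasure_compact_finite) simp
  qed simp_all
qed

lemma AE_lborel_neq: "AE x in lborel. x \<noteq> (c::real)"
  using AE_lborel_singleton[of c] by simp

text \<open>Along the lines x - m t = const the integrand is an exact t-derivative.\<close>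

lemma transport_integral:
  fixes g :: "real \<Rightarrow> real"
  assumes \<phi>: "C1c \<phi>" "tsupp \<phi> \<subseteq> {z. fst z < T}" and T: "0 < T"
    and g [measurable]: "g \<in> borel_measurable borel" and gB: "\<And>x. \<bar>g x\<bar> \<le> B"
  shows "(\<integral>z. indicator (strip T) z * (g (snd z - m * fst z) * (dt \<phi> z + m * dx \<phi> z)) \<partial>lborel)
         = - (\<integral>x. g x * \<phi> (0, x) \<partial>lborel)"
proof -
  note [measurable] = C1c_measurable[OF \<phi>(1)]
  obtain K where K: "K > 0"
    "\<And>z. z \<notin> {-K..K} \<times> {-K..K} \<Longrightarrow> \<phi> z = 0 \<and> dt \<phi> z = 0 \<and> dx \<phi> z = 0"
    "\<And>z. \<bar>\<phi> z\<bar> \<le> K \<and> \<bar>dt \<phi> z\<bar> \<le> K \<and> \<bar>dx \<phi> z\<bar> \<le> K"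
    using C1c_box[OF \<phi>(1)] by blast
  define P where "P z = dt \<phi> z + m * dx \<phi> z" for z
  have [measurable]: "P \<in> borel_measurable borel"
    unfolding P_def by measurable
  have P0: "P z = 0" if "z \<notin> {-K..K} \<times> {-K..K}" for z
    using K(2)[OF that] by (simp add: P_def)
  define F where "F t x = indicator {0<..<T} t * (g (x - m * t) * P (t, x))" for t x :: real
  have intP: "integrable lborel P"
    unfolding P_def using C1c_integrable[OF \<phi>(1)] by simp
  have [measurable]: "case_prod F \<in> borel_measurable (borel \<Otimes>\<^sub>M borel)"
    unfolding F_def by (simp add: split_beta)
  have B: "0 \<le> B" using gB[of 0] by linarith
  have intF: "integrable (lborel \<Otimes>\<^sub>M lborel) (case_prod F)"
    unfolding lborel_prod
  proof (rule Bochner_Integration.integrable_bound)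
    show "integrable lborel (\<lambda>z. B * P z)" using intP by simp
    show "case_prod F \<in> borel_measurable lborel"
      using \<open>case_prod F \<in> borel_measurable (borel \<Otimes>\<^sub>M borel)\<close> by (simp add: borel_prod)
    have "norm (F t x) \<le> norm (B * P (t, x))" for t x
      using B gB[of "x - m * t"] by (auto simp: F_def abs_mult indicator_def intro!: mult_right_mono)
    then have "norm (case_prod F z) \<le> norm (B * P z)" for z
      by (cases z) simp
    then show "AE z in lborel. norm (case_prod F z) \<le> norm (B * P z)"
      by (rule AE_I2)
  qed
  \<comment> \<open>\<open>G\<close> is \<open>F\<close> in the co-moving coordinate y = x - m t, in
    which the profile g no longer depends on t. Fubini is applied before and after this shear, hence
    the two separate integrability proofs.\<close>
  define G where "G t y = F t (y + m * t)" for t y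
  have G: "G t y = indicator {0<..<T} t * (g y * P (t, y + m * t))" for t y
    by (simp add: G_def F_def)
  have [measurable]: "case_prod G \<in> borel_measurable (borel \<Otimes>\<^sub>M borel)"
    unfolding G by (simp add: split_beta)
  \<comment> \<open>For |t| \<le> K and |x| \<le> K the sheared coordinate satisfies |y| \<le> K +
    |m| K.\<close>
  define L where "L = K + \<bar>m\<bar> * K"
  have intG: "integrable (lborel \<Otimes>\<^sub>M lborel) (case_prod G)"
    unfolding lborel_prod
  proof (rule integrableI_bounded_set[where A="{-K..K} \<times> {-L..L}" and B="B * (K + \<bar>m\<bar> * K)"])
    have c: "compact ({-K..K} \<times> {-L..L})"
      by (intro compact_Times) auto
    show "{-K..K} \<times> {-L..L} \<in> sets lborel"
      using c by (simp add: borel_compact)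
    show "emeasure lborel ({-K..K} \<times> {-L..L}) < \<infinity>"
      using emeasure_compact_finite[OF c] .
    show "case_prod G \<in> borel_measurable lborel"
      using \<open>case_prod G \<in> borel_measurable (borel \<Otimes>\<^sub>M borel)\<close> by (simp add: borel_prod)
    have "\<bar>P z\<bar> \<le> K + \<bar>m\<bar> * K" for z
      unfolding P_def using K(3)[of z]
      by (intro order_trans[OF abs_triangle_ineq] add_mono) (auto simp: abs_mult intro!: mult_left_mono)
    then have "norm (G t y) \<le> B * (K + \<bar>m\<bar> * K)" for t y
      using gB[of y] B K(1) by (auto simp: G abs_mult indicator_def intro!: mult_mono)
    then show "AE z in lborel. z \<in> {-K..K} \<times> {-L..L} \<longrightarrow> norm (case_prod G z) \<le> B * (K + \<bar>m\<bar> * K)"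
      by (simp add: split_beta)
    have "G t y = 0" if "(t, y) \<notin> {-K..K} \<times> {-L..L}" for t y
    proof (cases "t \<in> {-K..K}")
      case True
      with that have "\<bar>y\<bar> > L" by auto
      moreover have "\<bar>m * t\<bar> \<le> \<bar>m\<bar> * K"
        using True by (auto simp: abs_mult intro!: mult_left_mono)
      ultimately have "\<bar>y + m * t\<bar> > K" unfolding L_def by linarith
      then have "P (t, y + m * t) = 0" by (intro P0) auto
      then show ?thesis by (simp add: G)
    next
      case False
      then have "P (t, y + m * t) = 0" by (intro P0) auto
      then show ?thesis by (simp add: G)
    qed
    then show "AE z in lborel. z \<notin> {-K..K} \<times> {-L..L} \<longrightarrow> case_prod G z = 0"
      by (intro AE_I2) (metis case_prod_unfold prod.collapse)
  qed
  have inner: "(\<integral>t. G t y \<partial>lborel) = - (g y * \<phi> (0, y))" for y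
  proof -
    have "(\<integral>t. indicator {0..T} t *\<^sub>R P (t, y + m * t) \<partial>lborel) = \<phi> (T, y + m * T) - \<phi> (0, y + m * 0)"
    proof (rule integral_FTC_Icc)
      show "0 \<le> T" using T by simp
      show "((\<lambda>t. \<phi> (t, y + m * t)) has_vector_derivative P (t, y + m * t)) (at t within {0..T})" for t
        using C1c_DERIV_line[OF \<phi>(1)] unfolding P_def
        by (simp add: has_real_derivative_iff_has_vector_derivative has_vector_derivative_at_within)
      show "continuous_on {0..T} (\<lambda>t. P (t, y + m * t))"
        unfolding P_def
        by (intro continuous_intros continuous_on_compose2[OF C1c_continuous(2)[OF \<phi>(1)]]
            continuous_on_compose2[OF C1c_continuous(3)[OF \<phi>(1)]]) auto
    qed
    \<comment> \<open>The support lies strictly below time T, so only the endpoint t = 0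
      contributes.\<close>
    moreover have "\<phi> (T, y + m * T) = 0"
      using \<phi> by (intro C1c_eq_0(1)) auto
    moreover have "(\<integral>t. G t y \<partial>lborel) = (\<integral>t. g y * (indicator {0..T} t *\<^sub>R P (t, y + m * t)) \<partial>lborel)"
    proof (rule integral_cong_AE)
      show "AE t in lborel. G t y = g y * (indicator {0..T} t *\<^sub>R P (t, y + m * t))"
        using AE_lborel_neq[of 0] AE_lborel_neq[of T]
        by eventually_elim (auto simp: G indicator_def)
    qed (auto simp: G)
    ultimately show ?thesis by simp
  qed
  have "(\<integral>z. indicator (strip T) z * (g (snd z - m * fst z) * (dt \<phi> z + m * dx \<phi> z)) \<partial>lborel)
      = (\<integral>z. case_prod F z \<partial>(lborel \<Otimes>\<^sub>M lborel))"
    unfolding lborel_prod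
    by (rule Bochner_Integration.integral_cong) (auto simp: F_def P_def indicator_def)
  also have "\<dots> = (\<integral>t. (\<integral>x. F t x \<partial>lborel) \<partial>lborel)"
    using lborel_pair.integral_fst[OF intF] by simp
  also have "\<dots> = (\<integral>t. (\<integral>y. G t y \<partial>lborel) \<partial>lborel)"
    using lborel_integral_real_affine[where c=1 and f="F t" and t="m * t" for t]
    by (simp add: G_def add.commute)
  also have "\<dots> = (\<integral>y. (\<integral>t. G t y \<partial>lborel) \<partial>lborel)"
    using lborel_pair.Fubini_integral[OF intG] by simp
  finally show ?thesis
    by (simp add: inner)
qed

lemma transport_integral_vanishing:
  fixes g :: "real \<Rightarrow> real"
  assumes \<phi>: "C1c \<phi>" "tsupp \<phi> \<subseteq> strip T" and T: "0 < T"
    and g: "g \<in> borel_measurable borel" and gB: "\<And>x. \<bar>g x\<bar> \<le> B"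
  shows "(\<integral>z. indicator (strip T) z * (g (snd z - m * fst z) * (dt \<phi> z + m * dx \<phi> z)) \<partial>lborel) = 0"
proof -
  have "\<phi> (0, x) = 0" for x
    using \<phi> by (intro C1c_eq_0(1)) auto
  moreover have "tsupp \<phi> \<subseteq> {z. fst z < T}"
    using \<phi>(2) by auto
  ultimately show ?thesis
    using transport_integral[OF \<phi>(1) _ T g gB, of m] by simp
qed

text \<open>On each time slice the region c < e (x - m t) is a half-line with endpoint x = e c + m
  t, and the integral of \<open>dx \<phi>\<close> over it is the value at the endpoint up to sign;
  the factor e makes the sign the same for right and left half-lines. The resulting line integral
  measures both the variation carried by a front and the entropy produced on it.\<close>

lemma dx_half_plane_integral:
  assumes \<phi>: "C1c \<phi>" and e: "e = 1 \<or> e = (-1::real)"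
  shows "e * (\<integral>z. indicator (strip T) z *
             (indicator {x. c < e * x} (snd z - m * fst z) * dx \<phi> z) \<partial>lborel)
         = - (\<integral>t. indicator {0<..<T} t * \<phi> (t, e * c + m * t) \<partial>lborel)"
proof -
  note [measurable] = C1c_measurable[OF \<phi>(1)]
  obtain K where K: "K > 0"
    "\<And>z. z \<notin> {-K..K} \<times> {-K..K} \<Longrightarrow> \<phi> z = 0 \<and> dt \<phi> z = 0 \<and> dx \<phi> z = 0"
    "\<And>z. \<bar>\<phi> z\<bar> \<le> K \<and> \<bar>dt \<phi> z\<bar> \<le> K \<and> \<bar>dx \<phi> z\<bar> \<le> K"
    using C1c_box[OF \<phi>(1)] by blast
  define F where "F t x = indicator {0<..<T} t * (indicator {x. c < e * x} (x - m * t) * dx \<phi> (t, x))"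
    for t x :: real
  have [measurable]: "case_prod F \<in> borel_measurable (borel \<Otimes>\<^sub>M borel)"
    unfolding F_def by (simp add: split_beta)
  have intF: "integrable (lborel \<Otimes>\<^sub>M lborel) (case_prod F)"
    unfolding lborel_prod
  proof (rule Bochner_Integration.integrable_bound[OF C1c_integrable(2)[OF \<phi>]])
    show "case_prod F \<in> borel_measurable lborel"
      using \<open>case_prod F \<in> borel_measurable (borel \<Otimes>\<^sub>M borel)\<close> by (simp add: borel_prod)
    have "norm (F t x) \<le> norm (dx \<phi> (t, x))" for t x
      by (auto simp: F_def indicator_def)
    then have "norm (case_prod F z) \<le> norm (dx \<phi> z)" for z
      by (cases z) simp
    then show "AE z in lborel. norm (case_prod F z) \<le> norm (dx \<phi> z)"
      by (rule AE_I2)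
  qed
  have inner: "e * (\<integral>x. F t x \<partial>lborel) = - (indicator {0<..<T} t * \<phi> (t, e * c + m * t))" for t
  proof -
    define y where "y = e * c + m * t"
    have FTC: "(\<integral>x. indicator {p..q} x *\<^sub>R dx \<phi> (t, x) \<partial>lborel) = \<phi> (t, q) - \<phi> (t, p)"
      if "p \<le> q" for p q
    proof (rule integral_FTC_Icc[OF that])
      show "((\<lambda>x. \<phi> (t, x)) has_vector_derivative dx \<phi> (t, x)) (at x within {p..q})" for x
        using C1c_DERIV_dx[OF \<phi>(1)]
        by (simp add: has_real_derivative_iff_has_vector_derivative has_vector_derivative_at_within)
      show "continuous_on {p..q} (\<lambda>x. dx \<phi> (t, x))"
        by (intro continuous_intros continuous_on_compose2[OF C1c_continuous(3)[OF \<phi>(1)]]) auto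
    qed
    \<comment> \<open>Beyond both the support and the front, so that the half-line integral becomes
      one over a compact interval whose outer endpoint contributes nothing.\<close>
    define q where "q = \<bar>y\<bar> + K + 1"
    have yq: "- q \<le> y" "y \<le> q" using K(1) by (auto simp: q_def)
    have out: "\<phi> (t, q) = 0" "\<phi> (t, - q) = 0"
      by (rule K(2)[THEN conjunct1], use K(1) in \<open>auto simp: q_def\<close>)+
    have out': "dx \<phi> (t, x) = 0" if "q < \<bar>x\<bar>" for x
      by (rule K(2)[THEN conjunct2, THEN conjunct2], use that in \<open>auto simp: q_def\<close>)
    show ?thesis
    proof (cases "e = 1")
      case True
      have "(\<integral>x. F t x \<partial>lborel)
          = (\<integral>x. indicator {0<..<T} t * (indicator {y..q} x *\<^sub>R dx \<phi> (t, x)) \<partial>lborel)"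
      proof (rule integral_cong_AE)
        show "AE x in lborel. F t x = indicator {0<..<T} t * (indicator {y..q} x *\<^sub>R dx \<phi> (t, x))"
          using AE_lborel_neq[of y]
        proof eventually_elim
          case (elim x)
          have "c < x - m * t \<longleftrightarrow> y \<le> x"
            using elim True by (auto simp: y_def)
          moreover have "dx \<phi> (t, x) = 0" if "x > q"
            using out'[of x] that K(1) by (auto simp: q_def)
          ultimately show ?case
            using True by (auto simp: F_def indicator_def)
        qed
      qed (auto simp: F_def)
      then show ?thesis using True FTC[OF yq(2)] out by (simp add: y_def)
    next
      case False
      then have e: "e = -1" using e by simp
      have "(\<integral>x. F t x \<partial>lborel)
          = (\<integral>x. indicator {0<..<T} t * (indicator {-q..y} x *\<^sub>R dx \<phi> (t, x)) \<partial>lborel)"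
      proof (rule integral_cong_AE)
        show "AE x in lborel. F t x = indicator {0<..<T} t * (indicator {-q..y} x *\<^sub>R dx \<phi> (t, x))"
          using AE_lborel_neq[of y]
        proof eventually_elim
          case (elim x)
          have "c < - (x - m * t) \<longleftrightarrow> x \<le> y"
            using elim e by (auto simp: y_def)
          moreover have "dx \<phi> (t, x) = 0" if "x < - q"
            using out'[of x] that K(1) by (auto simp: q_def)
          ultimately show ?case
            using e by (auto simp: F_def indicator_def)
        qed
      qed (auto simp: F_def)
      then show ?thesis using e FTC[OF yq(1)] out by (simp add: y_def)
    qed
  qed
  have "(\<integral>z. indicator (strip T) z * (indicator {x. c < e * x} (snd z - m * fst z) * dx \<phi> z) \<partial>lborel)
      = (\<integral>z. case_prod F z \<partial>(lborel \<Otimes>\<^sub>M lborel))"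
    unfolding lborel_prod
    by (rule Bochner_Integration.integral_cong) (auto simp: F_def indicator_def)
  also have "\<dots> = (\<integral>t. (\<integral>x. F t x \<partial>lborel) \<partial>lborel)"
    using lborel_pair.integral_fst[OF intF] by simp
  finally have eq: "(\<integral>z. indicator (strip T) z * (indicator {x. c < e * x} (snd z - m * fst z) * dx \<phi> z) \<partial>lborel)
      = (\<integral>t. (\<integral>x. F t x \<partial>lborel) \<partial>lborel)" .
  have "(\<integral>t. e * (\<integral>x. F t x \<partial>lborel) \<partial>lborel)
      = (\<integral>t. - (indicator {0<..<T} t * \<phi> (t, e * c + m * t)) \<partial>lborel)"
    by (simp only: inner)
  then show ?thesis
    unfolding eq by simp
qed

section \<open>Superpositions of travelling steps\<close>

text \<open>Cutting off the product of \<psi> and \<alpha> by a measurable relation leaves it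
  dominated by the product itself. Hence testing a superposition against \<psi> amounts to testing
  each single step and integrating over s.\<close>

lemma Fubini_indicator:
  fixes \<psi> :: "'z::euclidean_space \<Rightarrow> real" and \<alpha> :: "real \<Rightarrow> 'b::{banach, second_countable_topology}"
  assumes \<psi>: "integrable lborel \<psi>" and \<alpha>: "integrable lborel \<alpha>"
    and P [measurable]: "Measurable.pred (borel \<Otimes>\<^sub>M borel) (\<lambda>p. P (fst p) (snd p))"
  shows "integrable lborel (\<lambda>z. \<psi> z *\<^sub>R (\<integral>s. indicator {s. P s z} s *\<^sub>R \<alpha> s \<partial>lborel))"
    and "integrable lborel (\<lambda>s. (\<integral>z. indicator {z. P s z} z * \<psi> z \<partial>lborel) *\<^sub>R \<alpha> s)"
    and "(\<integral>z. \<psi> z *\<^sub>R (\<integral>s. indicator {s. P s z} s *\<^sub>R \<alpha> s \<partial>lborel) \<partial>lborel)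
         = (\<integral>s. (\<integral>z. indicator {z. P s z} z * \<psi> z \<partial>lborel) *\<^sub>R \<alpha> s \<partial>lborel)"
proof -
  have [measurable]: "\<psi> \<in> borel_measurable borel" "\<alpha> \<in> borel_measurable borel"
    using borel_measurable_integrable[OF \<psi>] borel_measurable_integrable[OF \<alpha>] by simp_all
  define F where "F s z = (if P s z then \<psi> z *\<^sub>R \<alpha> s else 0)" for s z
  have int0: "integrable (lborel \<Otimes>\<^sub>M lborel) (\<lambda>p. \<psi> (snd p) *\<^sub>R \<alpha> (fst p))"
  proof (rule lborel_pair.Fubini_integrable)
    show "integrable lborel (\<lambda>s. \<integral>z. norm (\<psi> (snd (s, z)) *\<^sub>R \<alpha> (fst (s, z))) \<partial>lborel)"
      using \<psi> \<alpha> by simp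
    show "AE s in lborel. integrable lborel (\<lambda>z. \<psi> (snd (s, z)) *\<^sub>R \<alpha> (fst (s, z)))"
      using \<psi> by simp
  qed measurable
  have intF: "integrable (lborel \<Otimes>\<^sub>M lborel) (case_prod F)"
  proof (rule Bochner_Integration.integrable_bound[OF int0])
    show "case_prod F \<in> borel_measurable (lborel \<Otimes>\<^sub>M lborel)"
      unfolding F_def split_beta by measurable
    show "AE p in lborel \<Otimes>\<^sub>M lborel. norm (case_prod F p) \<le> norm (\<psi> (snd p) *\<^sub>R \<alpha> (fst p))"
      by (intro AE_I2) (simp add: F_def split_beta)
  qed
  have 1: "(\<integral>s. F s z \<partial>lborel) = \<psi> z *\<^sub>R (\<integral>s. indicator {s. P s z} s *\<^sub>R \<alpha> s \<partial>lborel)" for z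
  proof -
    have "(\<integral>s. F s z \<partial>lborel) = (\<integral>s. \<psi> z *\<^sub>R (indicator {s. P s z} s *\<^sub>R \<alpha> s) \<partial>lborel)"
      by (rule Bochner_Integration.integral_cong) (auto simp: F_def)
    then show ?thesis by (simp del: scaleR_scaleR)
  qed
  have 2: "(\<integral>z. F s z \<partial>lborel) = (\<integral>z. indicator {z. P s z} z * \<psi> z \<partial>lborel) *\<^sub>R \<alpha> s" for s
  proof -
    have [measurable]: "Measurable.pred borel (P s)"
      using measurable_compose[OF measurable_Pair1' P, of s] by simp
    have "integrable lborel (\<lambda>z. indicator {z. P s z} z * \<psi> z)"
      by (rule Bochner_Integration.integrable_bound[OF \<psi>]) (auto simp: indicator_def)
    moreover have "(\<integral>z. F s z \<partial>lborel) = (\<integral>z. (indicator {z. P s z} z * \<psi> z) *\<^sub>R \<alpha> s \<partial>lborel)"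
      by (rule Bochner_Integration.integral_cong) (auto simp: F_def)
    ultimately show ?thesis
      by (simp add: integral_scaleR_left)
  qed
  show "integrable lborel (\<lambda>z. \<psi> z *\<^sub>R (\<integral>s. indicator {s. P s z} s *\<^sub>R \<alpha> s \<partial>lborel))"
    using lborel_pair.integrable_snd[OF intF] by (simp add: 1)
  show "integrable lborel (\<lambda>s. (\<integral>z. indicator {z. P s z} z * \<psi> z \<partial>lborel) *\<^sub>R \<alpha> s)"
    using lborel_pair.integrable_fst[OF intF] by (simp add: 2)
  show "(\<integral>z. \<psi> z *\<^sub>R (\<integral>s. indicator {s. P s z} s *\<^sub>R \<alpha> s \<partial>lborel) \<partial>lborel)
         = (\<integral>s. (\<integral>z. indicator {z. P s z} z * \<psi> z \<partial>lborel) *\<^sub>R \<alpha> s \<partial>lborel)"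
    using lborel_pair.Fubini_integral[OF intF] by (simp add: 1 2)
qed

text \<open>The step with parameter s has height \<open>\<alpha> s\<close> and lives on one side of
  a front with speed \<open>m s\<close> and initial position \<open>d * k s\<close>: the right side
  for d = 1, the left side for d = -1.\<close>

definition travelling_steps ::
  "real \<Rightarrow> (real \<Rightarrow> real) \<Rightarrow> (real \<Rightarrow> real) \<Rightarrow> (real \<Rightarrow> 'b) \<Rightarrow> real \<times> real \<Rightarrow> 'b::{banach, second_countable_topology}"
  where "travelling_steps d k m \<alpha> z
    = (\<integral>s. indicator {s. k s < d * (snd z - m s * fst z)} s *\<^sub>R \<alpha> s \<partial>lborel)"

text \<open>The law A_t + B_x = 0 whose initial datum is the slice of A at t = 0. With density and
  flux as independent arguments the notion is linear in (A, B), unlike the weak form for u and f(u),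
  and therefore open to superposition.\<close>

definition weak_pair ::
  "real \<Rightarrow> (real \<times> real \<Rightarrow> 'b) \<Rightarrow> (real \<times> real \<Rightarrow> 'b::{banach, second_countable_topology}) \<Rightarrow> bool"
  where "weak_pair T A B \<longleftrightarrow> (\<forall>\<phi>. C1c \<phi> \<and> tsupp \<phi> \<subseteq> {z. fst z < T} \<longrightarrow>
    integrable lborel (\<lambda>z. indicator (strip T) z *\<^sub>R (dt \<phi> z *\<^sub>R A z + dx \<phi> z *\<^sub>R B z)) \<and>
    integrable lborel (\<lambda>x. \<phi> (0, x) *\<^sub>R A (0, x)) \<and>
    (\<integral>z. indicator (strip T) z *\<^sub>R (dt \<phi> z *\<^sub>R A z + dx \<phi> z *\<^sub>R B z) \<partial>lborel)
      + (\<integral>x. \<phi> (0, x) *\<^sub>R A (0, x) \<partial>lborel) = 0)"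

lemma weak_pair_add:
  assumes "weak_pair T A B" "weak_pair T A' B'"
  shows "weak_pair T (\<lambda>z. A z + A' z) (\<lambda>z. B z + B' z)"
  unfolding weak_pair_def
proof (intro allI impI)
  fix \<phi> :: "real \<times> real \<Rightarrow> real" assume \<phi>: "C1c \<phi> \<and> tsupp \<phi> \<subseteq> {z. fst z < T}"
  have eq1: "(\<lambda>z. indicator (strip T) z *\<^sub>R (dt \<phi> z *\<^sub>R (A z + A' z) + dx \<phi> z *\<^sub>R (B z + B' z)))
      = (\<lambda>z. indicator (strip T) z *\<^sub>R (dt \<phi> z *\<^sub>R A z + dx \<phi> z *\<^sub>R B z)
           + indicator (strip T) z *\<^sub>R (dt \<phi> z *\<^sub>R A' z + dx \<phi> z *\<^sub>R B' z))"
    by (auto simp: algebra_simps)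
  have eq2: "(\<lambda>x. \<phi> (0, x) *\<^sub>R (A (0, x) + A' (0, x)))
      = (\<lambda>x. \<phi> (0, x) *\<^sub>R A (0, x) + \<phi> (0, x) *\<^sub>R A' (0, x))"
    by (auto simp: algebra_simps)
  note 1 = assms(1)[unfolded weak_pair_def, rule_format, OF \<phi>]
  note 2 = assms(2)[unfolded weak_pair_def, rule_format, OF \<phi>]
  show "integrable lborel (\<lambda>z. indicator (strip T) z *\<^sub>R (dt \<phi> z *\<^sub>R (A z + A' z) + dx \<phi> z *\<^sub>R (B z + B' z))) \<and>
    integrable lborel (\<lambda>x. \<phi> (0, x) *\<^sub>R (A (0, x) + A' (0, x))) \<and>
    (\<integral>z. indicator (strip T) z *\<^sub>R (dt \<phi> z *\<^sub>R (A z + A' z) + dx \<phi> z *\<^sub>R (B z + B' z)) \<partial>lborel)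
      + (\<integral>x. \<phi> (0, x) *\<^sub>R (A (0, x) + A' (0, x)) \<partial>lborel) = 0"
    unfolding eq1 eq2 using 1 2
    by (simp add: Bochner_Integration.integral_add add_eq_0_iff2)
qed

lemma weak_pair_cong:
  assumes "weak_pair T A B" "\<And>z. 0 \<le> fst z \<Longrightarrow> fst z < T \<Longrightarrow> A z = A' z"
    "\<And>z. 0 \<le> fst z \<Longrightarrow> fst z < T \<Longrightarrow> B z = B' z" "0 < T"
  shows "weak_pair T A' B'"
proof -
  have "(\<lambda>z. indicator (strip T) z *\<^sub>R (dt \<phi> z *\<^sub>R A z + dx \<phi> z *\<^sub>R B z))
     = (\<lambda>z. indicator (strip T) z *\<^sub>R (dt \<phi> z *\<^sub>R A' z + dx \<phi> z *\<^sub>R B' z))" for \<phi>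
    using assms(2,3) by (auto simp: indicator_def fun_eq_iff)
  moreover have "A (0, x) = A' (0, x)" for x
    using assms(2)[of "(0, x)"] assms(4) by simp
  ultimately show ?thesis
    using assms(1) unfolding weak_pair_def by simp
qed

lemma integrable_indicator_mult:
  fixes \<psi> :: "'z::euclidean_space \<Rightarrow> real"
  assumes \<psi>: "integrable lborel \<psi>" and [measurable]: "S \<in> sets borel"
  shows "integrable lborel (\<lambda>z. indicator S z * \<psi> z)"
proof (rule Bochner_Integration.integrable_bound[OF \<psi>])
  have [measurable]: "\<psi> \<in> borel_measurable borel"
    using borel_measurable_integrable[OF \<psi>] by simp
  show "(\<lambda>z. indicator S z * \<psi> z) \<in> borel_measurable lborel"
    by measurable
  show "AE z in lborel. norm (indicator S z * \<psi> z) \<le> norm (\<psi> z)"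
    by (intro AE_I2) (auto simp: indicator_def)
qed

lemma integrable_strip_mult:
  fixes \<psi> :: "real \<times> real \<Rightarrow> real"
  assumes "integrable lborel \<psi>"
  shows "integrable lborel (\<lambda>z. indicator (strip T) z * \<psi> z)"
  by (intro integrable_indicator_mult assms borel_open open_Times) auto

lemma weak_pair_const:
  assumes T: "0 < T"
  shows "weak_pair T (\<lambda>_. c) (\<lambda>_. c')"
  unfolding weak_pair_def
proof (intro allI impI)
  fix \<phi> :: "real \<times> real \<Rightarrow> real" assume \<phi>: "C1c \<phi> \<and> tsupp \<phi> \<subseteq> {z. fst z < T}"
  then have C: "C1c \<phi>" by simp
  note int = C1c_integrable[OF C]
  have I: "integrable lborel (\<lambda>z. indicator (strip T) z * dt \<phi> z)"
     "integrable lborel (\<lambda>z. indicator (strip T) z * dx \<phi> z)"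
    using integrable_strip_mult int by auto
  have t: "(\<integral>z. indicator (strip T) z * dt \<phi> z \<partial>lborel) = - (\<integral>x. \<phi> (0, x) \<partial>lborel)"
    using transport_integral[of \<phi> T "\<lambda>_. 1" 1 0] \<phi> T by simp
  \<comment> \<open>Transport of the constant profile 1 gives the same right-hand side at speed 1
    and at speed 0; the difference isolates the integral of \<open>dx \<phi>\<close>.\<close>
  have "(\<integral>z. indicator (strip T) z * dt \<phi> z \<partial>lborel) + (\<integral>z. indicator (strip T) z * dx \<phi> z \<partial>lborel)
      = - (\<integral>x. \<phi> (0, x) \<partial>lborel)"
    using transport_integral[of \<phi> T "\<lambda>_. 1" 1 1] \<phi> T
    by (simp add: distrib_left Bochner_Integration.integral_add[OF I])
  with t have x: "(\<integral>z. indicator (strip T) z * dx \<phi> z \<partial>lborel) = 0"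
    by simp
  have eq: "(\<lambda>z. indicator (strip T) z *\<^sub>R (dt \<phi> z *\<^sub>R c + dx \<phi> z *\<^sub>R c'))
     = (\<lambda>z. (indicator (strip T) z * dt \<phi> z) *\<^sub>R c + (indicator (strip T) z * dx \<phi> z) *\<^sub>R c')"
    by (auto simp: algebra_simps)
  show "integrable lborel (\<lambda>z. indicator (strip T) z *\<^sub>R (dt \<phi> z *\<^sub>R c + dx \<phi> z *\<^sub>R c')) \<and>
    integrable lborel (\<lambda>x. \<phi> (0, x) *\<^sub>R c) \<and>
    (\<integral>z. indicator (strip T) z *\<^sub>R (dt \<phi> z *\<^sub>R c + dx \<phi> z *\<^sub>R c') \<partial>lborel)
      + (\<integral>x. \<phi> (0, x) *\<^sub>R c \<partial>lborel) = 0"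
    unfolding eq using I int by (simp add: Bochner_Integration.integral_add integral_scaleR_left t x)
qed

lemma pred_front:
  fixes k m :: "real \<Rightarrow> real"
  assumes [measurable]: "k \<in> borel_measurable borel" "m \<in> borel_measurable borel"
  shows "Measurable.pred (borel \<Otimes>\<^sub>M borel)
     (\<lambda>p. k (fst p) < d * (snd (snd p :: real \<times> real) - m (fst p) * fst (snd p)))"
proof -
  have [measurable]: "(\<lambda>p::real \<times> (real \<times> real). fst (snd p)) \<in> borel \<Otimes>\<^sub>M borel \<rightarrow>\<^sub>M borel"
    "(\<lambda>p::real \<times> (real \<times> real). snd (snd p)) \<in> borel \<Otimes>\<^sub>M borel \<rightarrow>\<^sub>M borel"
    unfolding borel_prod by (auto intro!: borel_measurable_continuous_onI continuous_intros)
  have [measurable]: "(\<lambda>p::real \<times> (real \<times> real). k (fst p)) \<in> borel_measurable (borel \<Otimes>\<^sub>M borel)"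
    "(\<lambda>p::real \<times> (real \<times> real). m (fst p)) \<in> borel_measurable (borel \<Otimes>\<^sub>M borel)"
    by (rule measurable_compose[OF measurable_fst], simp)+
  show ?thesis
    by (intro borel_measurable_pred_less borel_measurable_times borel_measurable_diff
        borel_measurable_const) simp_all
qed

lemma integrable_front_mult:
  fixes \<psi> :: "real \<times> real \<Rightarrow> real"
  assumes "integrable lborel \<psi>"
  shows "integrable lborel (\<lambda>z. indicator {z. k < d * (snd z - m * fst z)} z * \<psi> z)"
  by (intro integrable_indicator_mult assms borel_open open_Collect_less continuous_intros)

text \<open>The flux of one travelling step is speed times height, which is transport of an
  indicator profile. Fubini adds this up over s: twice in space-time for density and flux, once on
  the initial line for the datum.\<close>

lemma weak_pair_travelling_steps:
  assumes [measurable]: "k \<in> borel_measurable borel" "m \<in> borel_measurable borel"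
    and \<alpha>: "integrable lborel \<alpha>" and \<beta>: "integrable lborel (\<lambda>s. m s *\<^sub>R \<alpha> s)" and T: "0 < T"
  shows "weak_pair T (travelling_steps d k m \<alpha>) (travelling_steps d k m (\<lambda>s. m s *\<^sub>R \<alpha> s))"
  unfolding weak_pair_def
proof (intro allI impI)
  fix \<phi> :: "real \<times> real \<Rightarrow> real" assume \<phi>: "C1c \<phi> \<and> tsupp \<phi> \<subseteq> {z. fst z < T}"
  then have C: "C1c \<phi>" by simp
  let ?I = "indicator (strip T) :: real \<times> real \<Rightarrow> real"
  let ?H = "\<lambda>s z. indicator {z. k s < d * (snd z - m s * fst z)} z :: real"
  note int = integrable_strip_mult[OF C1c_integrable(1)[OF C], of T]
    integrable_strip_mult[OF C1c_integrable(2)[OF C], of T]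
  note F1 = Fubini_indicator[OF int(1) \<alpha> pred_front[of k m d], OF assms(1,2)]
  note F2 = Fubini_indicator[OF int(2) \<beta> pred_front[of k m d], OF assms(1,2)]
  have "Measurable.pred (borel \<Otimes>\<^sub>M borel) (\<lambda>p. k (fst p) < d * snd p)"
    by measurable
  note F3 = Fubini_indicator[OF C1c_integrable(3)[OF C, of 0] \<alpha> this]
  have eq: "?I z *\<^sub>R (dt \<phi> z *\<^sub>R travelling_steps d k m \<alpha> z + dx \<phi> z *\<^sub>R travelling_steps d k m (\<lambda>s. m s *\<^sub>R \<alpha> s) z)
    = (?I z * dt \<phi> z) *\<^sub>R (\<integral>s. indicator {s. k s < d * (snd z - m s * fst z)} s *\<^sub>R \<alpha> s \<partial>lborel)
    + (?I z * dx \<phi> z) *\<^sub>R (\<integral>s. indicator {s. k s < d * (snd z - m s * fst z)} s *\<^sub>R m s *\<^sub>R \<alpha> s \<partial>lborel)" for z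
    by (simp add: travelling_steps_def scaleR_add_right)
  have eq0: "\<phi> (0, x) *\<^sub>R travelling_steps d k m \<alpha> (0, x)
    = \<phi> (0, x) *\<^sub>R (\<integral>s. indicator {s. k s < d * x} s *\<^sub>R \<alpha> s \<partial>lborel)" for x
    by (simp add: travelling_steps_def)
  have front: "(\<integral>z. ?H s z * (?I z * dt \<phi> z) \<partial>lborel) + m s * (\<integral>z. ?H s z * (?I z * dx \<phi> z) \<partial>lborel)
      = - (\<integral>x. indicator {x. k s < d * x} x * \<phi> (0, x) \<partial>lborel)" for s
  proof -
    have "(\<integral>z. ?H s z * (?I z * dt \<phi> z) \<partial>lborel) + m s * (\<integral>z. ?H s z * (?I z * dx \<phi> z) \<partial>lborel)
      = (\<integral>z. ?H s z * (?I z * dt \<phi> z) + m s * (?H s z * (?I z * dx \<phi> z)) \<partial>lborel)"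
      using integrable_front_mult[OF int(1)] integrable_front_mult[OF int(2)] by simp
    also have "\<dots> = (\<integral>z. ?I z * (indicator {x. k s < d * x} (snd z - m s * fst z)
                       * (dt \<phi> z + m s * dx \<phi> z)) \<partial>lborel)"
      by (rule Bochner_Integration.integral_cong) (auto simp: indicator_def)
    also have "\<dots> = - (\<integral>x. indicator {x. k s < d * x} x * \<phi> (0, x) \<partial>lborel)"
      using \<phi> T by (intro transport_integral[where B=1]) (auto simp: indicator_def)
    finally show ?thesis .
  qed
  have "(\<integral>z. ?I z *\<^sub>R (dt \<phi> z *\<^sub>R travelling_steps d k m \<alpha> z
                + dx \<phi> z *\<^sub>R travelling_steps d k m (\<lambda>s. m s *\<^sub>R \<alpha> s) z) \<partial>lborel)
      = (\<integral>s. (\<integral>z. ?H s z * (?I z * dt \<phi> z) \<partial>lborel) *\<^sub>R \<alpha> s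
            + (\<integral>z. ?H s z * (?I z * dx \<phi> z) \<partial>lborel) *\<^sub>R m s *\<^sub>R \<alpha> s \<partial>lborel)"
    unfolding eq using F1 F2 by (simp add: Bochner_Integration.integral_add del: scaleR_scaleR)
  also have "\<dots> = (\<integral>s. - ((\<integral>x. indicator {x. k s < d * x} x * \<phi> (0, x) \<partial>lborel) *\<^sub>R \<alpha> s) \<partial>lborel)"
  proof (rule Bochner_Integration.integral_cong[OF refl])
    fix s
    have "(\<integral>z. ?H s z * (?I z * dt \<phi> z) \<partial>lborel) *\<^sub>R \<alpha> s
        + (\<integral>z. ?H s z * (?I z * dx \<phi> z) \<partial>lborel) *\<^sub>R m s *\<^sub>R \<alpha> s
      = ((\<integral>z. ?H s z * (?I z * dt \<phi> z) \<partial>lborel)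
           + m s * (\<integral>z. ?H s z * (?I z * dx \<phi> z) \<partial>lborel)) *\<^sub>R \<alpha> s"
      by (simp add: scaleR_add_left mult.commute)
    then show "(\<integral>z. ?H s z * (?I z * dt \<phi> z) \<partial>lborel) *\<^sub>R \<alpha> s
        + (\<integral>z. ?H s z * (?I z * dx \<phi> z) \<partial>lborel) *\<^sub>R m s *\<^sub>R \<alpha> s
      = - ((\<integral>x. indicator {x. k s < d * x} x * \<phi> (0, x) \<partial>lborel) *\<^sub>R \<alpha> s)"
      by (simp add: front)
  qed
  also have "\<dots> = - (\<integral>x. \<phi> (0, x) *\<^sub>R travelling_steps d k m \<alpha> (0, x) \<partial>lborel)"
    unfolding eq0 using F3(3) by simp
  finally show "integrable lborel (\<lambda>z. ?I z *\<^sub>R (dt \<phi> z *\<^sub>R travelling_steps d k m \<alpha> z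
                + dx \<phi> z *\<^sub>R travelling_steps d k m (\<lambda>s. m s *\<^sub>R \<alpha> s) z)) \<and>
    integrable lborel (\<lambda>x. \<phi> (0, x) *\<^sub>R travelling_steps d k m \<alpha> (0, x)) \<and>
    (\<integral>z. ?I z *\<^sub>R (dt \<phi> z *\<^sub>R travelling_steps d k m \<alpha> z
                + dx \<phi> z *\<^sub>R travelling_steps d k m (\<lambda>s. m s *\<^sub>R \<alpha> s) z) \<partial>lborel)
      + (\<integral>x. \<phi> (0, x) *\<^sub>R travelling_steps d k m \<alpha> (0, x) \<partial>lborel) = 0"
    unfolding eq eq0 using F1(1) F2(1) F3(1) by (intro conjI Bochner_Integration.integrable_add) auto
qed

section \<open>Total variation of superposed steps\<close>

text \<open>The dual form of finite total variation, on the whole strip with one bound M.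
  Integrability is part of the notion because the integral of a sum splits only for integrable
  summands.\<close>

definition bounded_divergence :: "real \<Rightarrow> (real \<times> real \<Rightarrow> real) \<Rightarrow> bool" where
  "bounded_divergence T w \<longleftrightarrow> (\<exists>M. \<forall>\<phi>1 \<phi>2. C1c \<phi>1 \<and> C1c \<phi>2 \<and> tsupp \<phi>1 \<subseteq> strip T \<and> tsupp \<phi>2 \<subseteq> strip T \<and>
     (\<forall>z. (\<phi>1 z)\<^sup>2 + (\<phi>2 z)\<^sup>2 \<le> 1) \<longrightarrow>
     integrable lborel (\<lambda>z. indicator (strip T) z * w z * (dt \<phi>1 z + dx \<phi>2 z)) \<and>
     (\<integral>z. indicator (strip T) z * w z * (dt \<phi>1 z + dx \<phi>2 z) \<partial>lborel) \<le> M)"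

lemma bounded_divergence_add:
  assumes "bounded_divergence T w" "bounded_divergence T w'"
  shows "bounded_divergence T (\<lambda>z. w z + w' z)"
proof -
  obtain M where M: "\<And>\<phi>1 \<phi>2. C1c \<phi>1 \<and> C1c \<phi>2 \<and> tsupp \<phi>1 \<subseteq> strip T \<and> tsupp \<phi>2 \<subseteq> strip T \<and>
     (\<forall>z. (\<phi>1 z)\<^sup>2 + (\<phi>2 z)\<^sup>2 \<le> 1) \<Longrightarrow>
     integrable lborel (\<lambda>z. indicator (strip T) z * w z * (dt \<phi>1 z + dx \<phi>2 z)) \<and>
     (\<integral>z. indicator (strip T) z * w z * (dt \<phi>1 z + dx \<phi>2 z) \<partial>lborel) \<le> M"
    using assms(1) unfolding bounded_divergence_def by blast
  obtain M' where M': "\<And>\<phi>1 \<phi>2. C1c \<phi>1 \<and> C1c \<phi>2 \<and> tsupp \<phi>1 \<subseteq> strip T \<and> tsupp \<phi>2 \<subseteq> strip T \<and>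
     (\<forall>z. (\<phi>1 z)\<^sup>2 + (\<phi>2 z)\<^sup>2 \<le> 1) \<Longrightarrow>
     integrable lborel (\<lambda>z. indicator (strip T) z * w' z * (dt \<phi>1 z + dx \<phi>2 z)) \<and>
     (\<integral>z. indicator (strip T) z * w' z * (dt \<phi>1 z + dx \<phi>2 z) \<partial>lborel) \<le> M'"
    using assms(2) unfolding bounded_divergence_def by blast
  have "integrable lborel (\<lambda>z. indicator (strip T) z * (w z + w' z) * (dt \<phi>1 z + dx \<phi>2 z)) \<and>
     (\<integral>z. indicator (strip T) z * (w z + w' z) * (dt \<phi>1 z + dx \<phi>2 z) \<partial>lborel) \<le> M + M'"
    if "C1c \<phi>1 \<and> C1c \<phi>2 \<and> tsupp \<phi>1 \<subseteq> strip T \<and> tsupp \<phi>2 \<subseteq> strip T \<and> (\<forall>z. (\<phi>1 z)\<^sup>2 + (\<phi>2 z)\<^sup>2 \<le> 1)"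
    for \<phi>1 \<phi>2
  proof -
    have eq: "(\<lambda>z. indicator (strip T) z * (w z + w' z) * (dt \<phi>1 z + dx \<phi>2 z))
       = (\<lambda>z. indicator (strip T) z * w z * (dt \<phi>1 z + dx \<phi>2 z)
            + indicator (strip T) z * w' z * (dt \<phi>1 z + dx \<phi>2 z))"
      by (auto simp: algebra_simps)
    show ?thesis
      unfolding eq using M[OF that] M'[OF that]
      by (auto simp: Bochner_Integration.integral_add intro: add_mono)
  qed
  then show ?thesis
    unfolding bounded_divergence_def by blast
qed

lemma bounded_divergence_cong:
  assumes "bounded_divergence T w" "\<And>z. z \<in> strip T \<Longrightarrow> w z = w' z"
  shows "bounded_divergence T w'"
proof -
  have "(\<lambda>z. indicator (strip T) z * w z * (dt \<phi>1 z + dx \<phi>2 z))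
    = (\<lambda>z. indicator (strip T) z * w' z * (dt \<phi>1 z + dx \<phi>2 z))" for \<phi>1 \<phi>2
    using assms(2) by (auto simp: indicator_def fun_eq_iff)
  with assms(1) show ?thesis
    unfolding bounded_divergence_def by simp
qed

lemma bounded_divergence_const:
  assumes T: "0 < T"
  shows "bounded_divergence T (\<lambda>_. c)"
  unfolding bounded_divergence_def
proof (intro exI allI impI)
  fix \<phi>1 \<phi>2 :: "real \<times> real \<Rightarrow> real"
  assume A: "C1c \<phi>1 \<and> C1c \<phi>2 \<and> tsupp \<phi>1 \<subseteq> strip T \<and> tsupp \<phi>2 \<subseteq> strip T \<and> (\<forall>z. (\<phi>1 z)\<^sup>2 + (\<phi>2 z)\<^sup>2 \<le> 1)"
  have z: "\<phi>1 (0, x) = 0" "\<phi>2 (0, x) = 0" for x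
    by (rule C1c_eq_0; use A in auto)+
  have s: "tsupp \<phi>1 \<subseteq> {z. fst z < T}" "tsupp \<phi>2 \<subseteq> {z. fst z < T}"
    using A by auto
  note 1 = weak_pair_const[OF T, of c 0, unfolded weak_pair_def, rule_format, of \<phi>1]
  note 2 = weak_pair_const[OF T, of 0 c, unfolded weak_pair_def, rule_format, of \<phi>2]
  have eq: "(\<lambda>z. indicator (strip T) z * c * (dt \<phi>1 z + dx \<phi>2 z))
       = (\<lambda>z. indicator (strip T) z * (dt \<phi>1 z * c) + indicator (strip T) z * (dx \<phi>2 z * c))"
    by (auto simp: algebra_simps)
  show "integrable lborel (\<lambda>z. indicator (strip T) z * c * (dt \<phi>1 z + dx \<phi>2 z)) \<and>
     (\<integral>z. indicator (strip T) z * c * (dt \<phi>1 z + dx \<phi>2 z) \<partial>lborel) \<le> 0"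
    unfolding eq using 1 2 A z s by (simp add: Bochner_Integration.integral_add)
qed

text \<open>The derivative of one unit step is concentrated on its front, a line over a time
  interval of length T: the x-part contributes at most T, the t-part at most |m| T. Multiplied by
  |\<alpha>| both bounds are integrable in s, which yields an M independent of the test
  functions.\<close>

lemma bounded_divergence_travelling_steps:
  fixes \<alpha> :: "real \<Rightarrow> real"
  assumes [measurable]: "k \<in> borel_measurable borel" "m \<in> borel_measurable borel"
    and \<alpha>: "integrable lborel \<alpha>" and \<beta>: "integrable lborel (\<lambda>s. m s * \<alpha> s)" and T: "0 < T"
    and d: "d = 1 \<or> d = -1"
  shows "bounded_divergence T (travelling_steps d k m \<alpha>)"
  unfolding bounded_divergence_def
proof (intro exI allI impI)
  fix \<phi>1 \<phi>2 :: "real \<times> real \<Rightarrow> real"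
  assume A: "C1c \<phi>1 \<and> C1c \<phi>2 \<and> tsupp \<phi>1 \<subseteq> strip T \<and> tsupp \<phi>2 \<subseteq> strip T \<and> (\<forall>z. (\<phi>1 z)\<^sup>2 + (\<phi>2 z)\<^sup>2 \<le> 1)"
  then have C: "C1c \<phi>1" "C1c \<phi>2" by auto
  let ?I = "indicator (strip T) :: real \<times> real \<Rightarrow> real"
  let ?H = "\<lambda>s z. indicator {z. k s < d * (snd z - m s * fst z)} z :: real"
  have b: "\<bar>\<phi>1 z\<bar> \<le> 1" "\<bar>\<phi>2 z\<bar> \<le> 1" for z
  proof -
    have "(\<phi>1 z)\<^sup>2 + (\<phi>2 z)\<^sup>2 \<le> 1" using A by blast
    then have "(\<phi>1 z)\<^sup>2 \<le> 1" "(\<phi>2 z)\<^sup>2 \<le> 1"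
      using zero_le_power2[of "\<phi>1 z"] zero_le_power2[of "\<phi>2 z"] by linarith+
    then show "\<bar>\<phi>1 z\<bar> \<le> 1" "\<bar>\<phi>2 z\<bar> \<le> 1" by (simp_all add: abs_square_le_1)
  qed
  have dxb: "\<bar>\<integral>z. ?H s z * (?I z * dx \<phi> z) \<partial>lborel\<bar> \<le> T" if "C1c \<phi>" "\<And>z. \<bar>\<phi> z\<bar> \<le> 1" for \<phi> s
  proof -
    note [measurable] = C1c_measurable[OF that(1)]
    have "(\<integral>z. ?H s z * (?I z * dx \<phi> z) \<partial>lborel)
      = (\<integral>z. ?I z * (indicator {x. k s < d * x} (snd z - m s * fst z) * dx \<phi> z) \<partial>lborel)"
      by (rule Bochner_Integration.integral_cong) (auto simp: indicator_def)
    moreover have "d * \<dots> = - (\<integral>t. indicator {0<..<T} t * \<phi> (t, d * k s + m s * t) \<partial>lborel)"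
      by (rule dx_half_plane_integral[OF that(1) d])
    ultimately have "\<bar>\<integral>z. ?H s z * (?I z * dx \<phi> z) \<partial>lborel\<bar>
       = \<bar>\<integral>t. indicator {0<..<T} t * \<phi> (t, d * k s + m s * t) \<partial>lborel\<bar>"
      using d by auto
    also have "\<dots> \<le> (\<integral>t. indicator {0<..<T} t \<partial>lborel)"
    proof (rule integral_abs_bound_integral)
      show 1: "integrable lborel (\<lambda>t. indicator {0<..<T} t :: real)"
        using T by simp
      show "integrable lborel (\<lambda>t. indicator {0<..<T} t * \<phi> (t, d * k s + m s * t))"
        using that(2) by (intro Bochner_Integration.integrable_bound[OF 1]) (auto simp: indicator_def)
      show "\<bar>indicator {0<..<T} t * \<phi> (t, d * k s + m s * t)\<bar> \<le> indicator {0<..<T} t" for t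
        using that(2) by (auto simp: indicator_def)
    qed
    also have "\<dots> = T" using T by simp
    finally show ?thesis .
  qed
  note int = integrable_strip_mult[OF C1c_integrable(1)[OF C(1)], of T]
    integrable_strip_mult[OF C1c_integrable(2)[OF C(1)], of T]
    integrable_strip_mult[OF C1c_integrable(2)[OF C(2)], of T]
  \<comment> \<open>Tests vanishing at t = 0 and near t = T make the transport integral zero, which
    trades \<open>dt\<close> for - m times \<open>dx\<close> on the front.\<close>
  have dtb: "\<bar>\<integral>z. ?H s z * (?I z * dt \<phi>1 z) \<partial>lborel\<bar> \<le> \<bar>m s\<bar> * T" for s
  proof -
    have "(\<integral>z. ?H s z * (?I z * dt \<phi>1 z) \<partial>lborel) + m s * (\<integral>z. ?H s z * (?I z * dx \<phi>1 z) \<partial>lborel)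
      = (\<integral>z. ?H s z * (?I z * dt \<phi>1 z) + m s * (?H s z * (?I z * dx \<phi>1 z)) \<partial>lborel)"
      using integrable_front_mult[OF int(1)] integrable_front_mult[OF int(2)] by simp
    also have "\<dots> = (\<integral>z. ?I z * (indicator {x. k s < d * x} (snd z - m s * fst z)
                       * (dt \<phi>1 z + m s * dx \<phi>1 z)) \<partial>lborel)"
      by (rule Bochner_Integration.integral_cong) (auto simp: indicator_def)
    also have "\<dots> = 0"
      using A T by (intro transport_integral_vanishing[where B=1]) (auto simp: indicator_def)
    finally have "\<bar>\<integral>z. ?H s z * (?I z * dt \<phi>1 z) \<partial>lborel\<bar> = \<bar>m s\<bar> * \<bar>\<integral>z. ?H s z * (?I z * dx \<phi>1 z) \<partial>lborel\<bar>"
      by (simp add: add_eq_0_iff2 abs_mult)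
    also have "\<dots> \<le> \<bar>m s\<bar> * T"
      using dxb[OF C(1) b(1)] by (intro mult_left_mono) auto
    finally show ?thesis .
  qed
  have int2: "integrable lborel (\<lambda>z. ?I z * (dt \<phi>1 z + dx \<phi>2 z))"
    using int(1,3) by (simp add: distrib_left)
  note F = Fubini_indicator[OF int2 \<alpha> pred_front[of k m d], OF assms(1,2)]
  have eq: "?I z * travelling_steps d k m \<alpha> z * (dt \<phi>1 z + dx \<phi>2 z)
    = (?I z * (dt \<phi>1 z + dx \<phi>2 z)) *\<^sub>R
        (\<integral>s. indicator {s. k s < d * (snd z - m s * fst z)} s *\<^sub>R \<alpha> s \<partial>lborel)" for z
    by (simp add: travelling_steps_def)
  have bound: "\<bar>(\<integral>z. ?H s z * (?I z * (dt \<phi>1 z + dx \<phi>2 z)) \<partial>lborel) *\<^sub>R \<alpha> s\<bar> \<le> T * \<bar>m s * \<alpha> s\<bar> + T * \<bar>\<alpha> s\<bar>" for s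
  proof -
    have "(\<integral>z. ?H s z * (?I z * (dt \<phi>1 z + dx \<phi>2 z)) \<partial>lborel)
       = (\<integral>z. ?H s z * (?I z * dt \<phi>1 z) \<partial>lborel) + (\<integral>z. ?H s z * (?I z * dx \<phi>2 z) \<partial>lborel)"
      using integrable_front_mult[OF int(1)] integrable_front_mult[OF int(3)]
      by (simp add: distrib_left)
    then have "\<bar>\<integral>z. ?H s z * (?I z * (dt \<phi>1 z + dx \<phi>2 z)) \<partial>lborel\<bar> \<le> \<bar>m s\<bar> * T + T"
      using dtb[of s] dxb[OF C(2) b(2), of s] by linarith
    then have "\<bar>\<integral>z. ?H s z * (?I z * (dt \<phi>1 z + dx \<phi>2 z)) \<partial>lborel\<bar> * \<bar>\<alpha> s\<bar> \<le> (\<bar>m s\<bar> * T + T) * \<bar>\<alpha> s\<bar>"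
      by (intro mult_right_mono) auto
    then show ?thesis by (simp add: abs_mult algebra_simps)
  qed
  have "(\<integral>z. ?I z * travelling_steps d k m \<alpha> z * (dt \<phi>1 z + dx \<phi>2 z) \<partial>lborel)
     = (\<integral>s. (\<integral>z. ?H s z * (?I z * (dt \<phi>1 z + dx \<phi>2 z)) \<partial>lborel) *\<^sub>R \<alpha> s \<partial>lborel)"
    unfolding eq by (rule F(3))
  also have "\<dots> \<le> (\<integral>s. T * \<bar>m s * \<alpha> s\<bar> + T * \<bar>\<alpha> s\<bar> \<partial>lborel)"
    using bound \<alpha> \<beta> by (intro integral_mono[OF F(2)]) (auto intro: abs_le_D1)
  finally show "integrable lborel (\<lambda>z. ?I z * travelling_steps d k m \<alpha> z * (dt \<phi>1 z + dx \<phi>2 z)) \<and>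
     (\<integral>z. ?I z * travelling_steps d k m \<alpha> z * (dt \<phi>1 z + dx \<phi>2 z) \<partial>lborel)
       \<le> (\<integral>s. T * \<bar>m s * \<alpha> s\<bar> + T * \<bar>\<alpha> s\<bar> \<partial>lborel)"
    unfolding eq using F(1) by simp
qed

section \<open>Fans and the explicit solution\<close>

locale fan =
  fixes b :: real and R :: "real \<Rightarrow> real^'n" and l :: "real \<Rightarrow> real"
  assumes b: "0 < b" and l_cont: "continuous_on {0..b} l"
    and l_dec: "\<And>s t. 0 \<le> s \<Longrightarrow> s < t \<Longrightarrow> t \<le> b \<Longrightarrow> l t < l s"
    and R_cont: "continuous_on {0..b} R"
begin

text \<open>The inverse of the speed, with the argument clamped to the attained range [l b, l 0].
  Speeds below l b return b and speeds above l 0 return 0, so the fan carries its two outer constant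
  states along.\<close>

definition W :: "real \<Rightarrow> real" where
  "W \<xi> = inv_into {0..b} l (min (l 0) (max (l b) \<xi>))"

definition Q :: "real \<Rightarrow> real^'n" where
  "Q \<xi> = R (W \<xi>)"

lemma l_le: "0 \<le> s \<Longrightarrow> s \<le> t \<Longrightarrow> t \<le> b \<Longrightarrow> l t \<le> l s"
  using l_dec[of s t] by (cases "s = t") auto

lemma l_b_less: "l b < l 0"
  using l_dec[of 0 b] b by simp

lemma inj_l: "inj_on l {0..b}"
  by (rule linorder_inj_onI) (use l_dec in \<open>force+\<close>)

lemma l_image: "l ` {0..b} = {l b..l 0}"
proof
  show "l ` {0..b} \<subseteq> {l b..l 0}"
    using l_le b by auto
  show "{l b..l 0} \<subseteq> l ` {0..b}"
    using IVT2'[of l b _ 0] b l_cont by force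
qed

lemma W_in: "0 \<le> W \<xi>" "W \<xi> \<le> b" and l_W: "l (W \<xi>) = min (l 0) (max (l b) \<xi>)"
proof -
  have "min (l 0) (max (l b) \<xi>) \<in> l ` {0..b}"
    unfolding l_image using l_b_less by auto
  from inv_into_into[OF this] f_inv_into_f[OF this]
  show "0 \<le> W \<xi>" "W \<xi> \<le> b" "l (W \<xi>) = min (l 0) (max (l b) \<xi>)"
    by (auto simp: W_def)
qed

lemma W_low: "\<xi> \<le> l b \<Longrightarrow> W \<xi> = b"
  using l_W[of \<xi>] W_in[of \<xi>] l_b_less b l_dec[of "W \<xi>" b] by (cases "W \<xi> = b") auto

lemma W_high: "l 0 \<le> \<xi> \<Longrightarrow> W \<xi> = 0"
  using l_W[of \<xi>] W_in[of \<xi>] l_b_less b l_dec[of 0 "W \<xi>"] by (cases "W \<xi> = 0") auto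

lemma Q_low: "\<xi> \<le> l b \<Longrightarrow> Q \<xi> = R b"
  by (simp add: Q_def W_low)

lemma Q_high: "l 0 \<le> \<xi> \<Longrightarrow> Q \<xi> = R 0"
  by (simp add: Q_def W_high)

text \<open>This equivalence is what describes the fan by fronts of constant speed. The value s = 0
  is excluded because of the clamp: for \<xi> > l 0 one has l 0 < \<xi> although
  \<open>W \<xi>\<close> is 0.\<close>

lemma W_less_iff:
  assumes "0 < s" "s \<le> b"
  shows "l s < \<xi> \<longleftrightarrow> W \<xi> < s"
proof
  assume "l s < \<xi>"
  then have "l s < l (W \<xi>)"
    unfolding l_W using l_dec[of 0 s] assms by auto
  then show "W \<xi> < s"
    using l_le[of s "W \<xi>"] W_in[of \<xi>] assms by force
next
  assume "W \<xi> < s"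
  then have "l s < l (W \<xi>)"
    using l_dec[of "W \<xi>" s] W_in[of \<xi>] assms by simp
  then show "l s < \<xi>"
    unfolding l_W using l_le[of s b] assms by (auto simp: min_def max_def split: if_splits)
qed

lemma W_cont: "continuous_on UNIV W"
proof -
  have "continuous_on (l ` {0..b}) (inv_into {0..b} l)"
    using continuous_on_inv[OF l_cont compact_Icc] inj_l by (auto simp: inv_into_f_f)
  moreover have "continuous_on UNIV (\<lambda>\<xi>. min (l 0) (max (l b) \<xi>))"
    by (intro continuous_intros)
  ultimately show ?thesis
    unfolding W_def
    by (rule continuous_on_compose2) (use l_b_less in \<open>auto simp: l_image\<close>)
qed

lemma Q_cont: "continuous_on UNIV Q"
  unfolding Q_def by (rule continuous_on_compose2[OF R_cont W_cont]) (use W_in in auto)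

lemma Q_in: "Q \<xi> \<in> R ` {0..b}"
  using W_in[of \<xi>] by (auto simp: Q_def)

text \<open>Constant extension of l to the whole line, which makes the fronts Borel measurable in s;
  densities supported in [0, b] do not notice it.\<close>

definition clamped_speed :: "real \<Rightarrow> real" where
  "clamped_speed s = l (max 0 (min b s))"

lemma clamped_speed_eq: "0 \<le> s \<Longrightarrow> s \<le> b \<Longrightarrow> clamped_speed s = l s"
  by (simp add: clamped_speed_def max_def min_def)

lemma clamped_speed_measurable [measurable]: "clamped_speed \<in> borel_measurable borel"
proof (rule borel_measurable_continuous_onI)
  show "continuous_on UNIV clamped_speed"
    unfolding clamped_speed_def
    by (rule continuous_on_compose2[OF l_cont]) (use b in \<open>auto intro!: continuous_intros\<close>)
qed

text \<open>As \<xi> grows, the profile runs through R from b towards 0, whence the density -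
  \<gamma>. The fundamental theorem on [\<open>W \<xi>\<close>, b] applies to any differentiable
  observable g of the state, and up to null sets the parameters in this interval are those with
  speed below \<xi>.\<close>

lemma fan_superposition:
  fixes g :: "real^'n \<Rightarrow> 'c::euclidean_space"
  assumes g: "\<And>s. 0 \<le> s \<Longrightarrow> s \<le> b \<Longrightarrow> ((\<lambda>s. g (R s)) has_vector_derivative \<gamma> s) (at s within {0..b})"
    and \<gamma>: "continuous_on {0..b} \<gamma>"
  shows "g (Q \<xi>) = g (R b) + (\<integral>s. indicator {s. clamped_speed s < \<xi>} s *\<^sub>R
           (indicator {0..b} s *\<^sub>R - \<gamma> s) \<partial>lborel)"
proof -
  have "(\<integral>s. indicator {W \<xi>..b} s *\<^sub>R - \<gamma> s \<partial>lborel) = - g (R b) - - g (R (W \<xi>))"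
  proof (rule integral_FTC_Icc[OF W_in(2)])
    show "((\<lambda>s. - g (R s)) has_vector_derivative - \<gamma> s) (at s within {W \<xi>..b})"
      if "W \<xi> \<le> s" "s \<le> b" for s
      using has_vector_derivative_within_subset[OF g[of s]] that W_in[of \<xi>]
      by (intro derivative_intros) auto
    show "continuous_on {W \<xi>..b} (\<lambda>s. - \<gamma> s)"
      using continuous_on_subset[OF \<gamma>] W_in[of \<xi>] by (intro continuous_intros) auto
  qed
  moreover have "(\<integral>s. indicator {s. clamped_speed s < \<xi>} s *\<^sub>R (indicator {0..b} s *\<^sub>R - \<gamma> s) \<partial>lborel)
      = (\<integral>s. indicator {W \<xi>..b} s *\<^sub>R - \<gamma> s \<partial>lborel)"
  proof (rule integral_cong_AE)
    have "(\<lambda>s. indicator {0..b} s *\<^sub>R - \<gamma> s) \<in> borel_measurable borel"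
      by (intro borel_measurable_continuous_on_indicator continuous_intros \<gamma>) simp
    then have m: "(\<lambda>s. indicator {0..b} s *\<^sub>R - \<gamma> s) \<in> borel_measurable lborel"
      by simp
    show "(\<lambda>s. indicator {s. clamped_speed s < \<xi>} s *\<^sub>R (indicator {0..b} s *\<^sub>R - \<gamma> s)) \<in> borel_measurable lborel"
      by (rule borel_measurable_scaleR[OF _ m]) measurable
    show "(\<lambda>s. indicator {W \<xi>..b} s *\<^sub>R - \<gamma> s) \<in> borel_measurable lborel"
      using borel_measurable_continuous_on_indicator[of "{W \<xi>..b}" "\<lambda>s. - \<gamma> s"]
        continuous_on_subset[OF \<gamma>, of "{W \<xi>..b}"] W_in[of \<xi>]
      by (auto intro!: continuous_intros)
    \<comment> \<open>Two parameters are discarded: \<open>W \<xi>\<close>, where strict and weak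
      inequality differ, and 0, which \<open>W_less_iff\<close> does not cover.\<close>
    show "AE s in lborel. indicator {s. clamped_speed s < \<xi>} s *\<^sub>R (indicator {0..b} s *\<^sub>R - \<gamma> s)
         = indicator {W \<xi>..b} s *\<^sub>R - \<gamma> s"
      using AE_lborel_neq[of "W \<xi>"] AE_lborel_neq[of 0]
    proof eventually_elim
      case (elim s)
      show ?case
      proof (cases "0 < s \<and> s \<le> b")
        case True
        then have "clamped_speed s < \<xi> \<longleftrightarrow> W \<xi> < s"
          using W_less_iff[of s \<xi>] by (simp add: clamped_speed_eq)
        with True elim show ?thesis by (auto simp: indicator_def)
      next
        case False
        then show ?thesis using elim W_in[of \<xi>] by (auto simp: indicator_def)
      qed
    qed
  qed
  ultimately show ?thesis by (simp add: Q_def)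
qed

end

text \<open>In the variable e x the solution consists of a constant state R 0, a compression fan focusing
  at time 2, the state R b on [-C, C], a rarefaction fan centred at time -1, the state R 0
  again, and finally the shock to w.\<close>

locale fan_shock = fan b R l for b :: real and R :: "real \<Rightarrow> real^'n" and l :: "real \<Rightarrow> real" +
  fixes e \<sigma> C :: real and w :: "real^'n"
  assumes e: "e = 1 \<or> e = -1" and lax: "l 0 \<le> e * \<sigma>" and C: "0 \<le> C"
begin

text \<open>Focus of the compression fan in the variable e x. The slow edge x1 + (t - 2) l b is at
  most x1 + 2 |l b| = - C for t in [0, 1].\<close>

definition x1 :: real where "x1 = - C - 2 * \<bar>l b\<bar>"
text \<open>Centre of the rarefaction fan. The part C + 2 |l b| keeps the slow edge x2 + (t + 1) l b
  at or above C; the part |l 0| + |\<sigma>| + 1 keeps the shock, which starts at x2 + l 0, strictly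
  above C up to time 1.\<close>

definition x2 :: real where "x2 = C + 2 * \<bar>l b\<bar> + \<bar>l 0\<bar> + \<bar>\<sigma>\<bar> + 1"

text \<open>The region ahead of the shock. Its start x2 + l 0 is the fast edge of the rarefaction at
  t = 0; that edge moves with speed l 0 \<le> e \<sigma>, so the shock never enters the fan.\<close>

definition front :: "(real \<times> real) set" where
  "front = {z. x2 + l 0 < e * (snd z - \<sigma> * fst z)}"

text \<open>For t in [0, 1] the switch at e x = 0 lies inside the plateau, where both formulas
  return R b, so it creates no jump. Other times lie beyond the horizon; there the formula only
  makes the function total.\<close>

definition u :: "real \<times> real \<Rightarrow> real^'n" where
  "u z = (if z \<in> front then w
          else if e * snd z \<le> 0 then Q ((e * snd z - x1) / (fst z - 2))
          else Q ((e * snd z - x2) / (fst z + 1)))"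

lemma ee: "e * (e * x) = x"
  using e by auto

lemma front_measurable [measurable]: "front \<in> sets borel"
  unfolding front_def by (intro borel_open open_Collect_less continuous_intros)

lemma compression_low:
  assumes "0 \<le> t" "t \<le> 1" "- C \<le> y"
  shows "(y - x1) / (t - 2) \<le> l b"
proof -
  have "l b * (t - 2) \<le> \<bar>l b\<bar> * 2"
    using assms abs_ge_self[of "- l b"] mult_mono[of "- l b" "\<bar>l b\<bar>" "2 - t" 2]
    by (simp add: algebra_simps)
  then show ?thesis
    using assms by (simp add: divide_le_eq x1_def algebra_simps)
qed

lemma rarefaction_low:
  assumes "0 \<le> t" "t \<le> 1" "y \<le> C"
  shows "(y - x2) / (t + 1) \<le> l b"
proof -
  have "- (l b) * (t + 1) \<le> \<bar>l b\<bar> * 2"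
    using assms by (intro mult_mono) auto
  then show ?thesis
    using assms by (simp add: divide_le_eq x2_def algebra_simps)
qed

lemma rarefaction_high:
  assumes "0 \<le> t" "t \<le> 1" "x2 + l 0 + e * \<sigma> * t \<le> y"
  shows "l 0 \<le> (y - x2) / (t + 1)"
proof -
  have "l 0 * t \<le> e * \<sigma> * t"
    using assms lax by (intro mult_right_mono) auto
  then show ?thesis
    using assms by (simp add: le_divide_eq algebra_simps)
qed

lemma front_iff: "(t, x) \<in> front \<longleftrightarrow> x2 + l 0 + e * \<sigma> * t < e * x"
  by (auto simp: front_def algebra_simps)

lemma front_far:
  assumes "0 \<le> t" "t \<le> 1"
  shows "C < x2 + l 0 + e * \<sigma> * t"
proof -
  have "\<bar>e * \<sigma> * t\<bar> \<le> \<bar>\<sigma>\<bar> * 1"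
    using assms e by (auto simp: abs_mult intro!: mult_left_le)
  then show ?thesis
    unfolding x2_def by linarith
qed

text \<open>The transition zones do not overlap: where one wave varies, the others sit at a constant
  state. Hence even a nonlinear observable g of u is a sum of contributions of single waves, and f,
  \<open>eta\<close> and q can be treated like the state itself.\<close>

lemma u_decomposition:
  fixes g :: "real^'n \<Rightarrow> 'c::real_vector"
  assumes "0 \<le> t" "t \<le> 1"
  shows "g (u (t, x)) = g (Q ((e * x - x1) / (t - 2))) + g (Q ((e * x - x2) / (t + 1))) - g (R b)
           + indicator front (t, x) *\<^sub>R (g w - g (R 0))"
proof (cases "(t, x) \<in> front")
  case True
  then have "x2 + l 0 + e * \<sigma> * t < e * x" by (simp add: front_iff)
  then have "Q ((e * x - x2) / (t + 1)) = R 0" "Q ((e * x - x1) / (t - 2)) = R b"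
    using assms front_far[OF assms] C by (auto intro!: Q_high rarefaction_high Q_low compression_low)
  with True show ?thesis by (simp add: u_def)
next
  case False
  then show ?thesis
    using assms C Q_low[OF compression_low[OF assms, of "e * x"]]
      Q_low[OF rarefaction_low[OF assms, of "e * x"]] by (auto simp: u_def)
qed

lemma u_in: "u z \<in> insert w (R ` {0..b})"
  using Q_in by (auto simp: u_def)

lemma u_observable_measurable:
  fixes g :: "real^'n \<Rightarrow> 'c::euclidean_space"
  assumes g: "continuous_on (R ` {0..b}) g"
  shows "(\<lambda>z. g (u z)) \<in> borel_measurable borel"
proof -
  have "continuous_on UNIV (\<lambda>\<xi>. g (Q \<xi>))"
    by (rule continuous_on_compose2[OF g Q_cont]) (use Q_in in auto)
  then have [measurable]: "(\<lambda>\<xi>. g (Q \<xi>)) \<in> borel_measurable borel"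
    by (rule borel_measurable_continuous_onI)
  have [measurable]: "(fst :: real \<times> real \<Rightarrow> real) \<in> borel_measurable borel"
    "(snd :: real \<times> real \<Rightarrow> real) \<in> borel_measurable borel"
    by (auto intro!: borel_measurable_continuous_onI continuous_intros)
  have "(\<lambda>z. g (u z)) = (\<lambda>z. if z \<in> front then g w
          else if e * snd z \<le> 0 then g (Q ((e * snd z - x1) / (fst z - 2)))
          else g (Q ((e * snd z - x2) / (fst z + 1))))"
    by (auto simp: u_def)
  also have "\<dots> \<in> borel_measurable borel"
    by measurable
  finally show ?thesis .
qed

text \<open>Since t - 2 is negative on [0, 1], solving \<open>clamped_speed s < \<xi>\<close> for x
  reverses the inequality, so these steps have direction - e. For s in [0, b] the front is the line
  e x = x1 + (t - 2) l s through the focus.\<close>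

abbreviation fan_steps1 :: "(real \<Rightarrow> 'c::euclidean_space) \<Rightarrow> real \<times> real \<Rightarrow> 'c" where
  "fan_steps1 \<equiv> travelling_steps (- e) (\<lambda>s. 2 * clamped_speed s - x1) (\<lambda>s. e * clamped_speed s)"

abbreviation fan_steps2 :: "(real \<Rightarrow> 'c::euclidean_space) \<Rightarrow> real \<times> real \<Rightarrow> 'c" where
  "fan_steps2 \<equiv> travelling_steps e (\<lambda>s. x2 + clamped_speed s) (\<lambda>s. e * clamped_speed s)"

text \<open>A single jump spread over a parameter interval of length 1, with the same front for
  every parameter, so that the results on superpositions cover it.\<close>

abbreviation shock_step :: "'c::euclidean_space \<Rightarrow> real \<times> real \<Rightarrow> 'c" where
  "shock_step c \<equiv> travelling_steps e (\<lambda>_. x2 + l 0) (\<lambda>_. \<sigma>) (\<lambda>s. indicator {0..1} s *\<^sub>R c)"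

lemma shock_step_eq: "shock_step c z = indicator front z *\<^sub>R c"
proof -
  have "shock_step c z = (\<integral>s. indicator {0..1::real} s *\<^sub>R (indicator front z *\<^sub>R c) \<partial>lborel)"
    unfolding travelling_steps_def
    by (rule Bochner_Integration.integral_cong) (auto simp: front_def indicator_def)
  also have "\<dots> = indicator front z *\<^sub>R c"
    by (subst integral_scaleR_left) auto
  finally show ?thesis .
qed

lemma u_superposition:
  fixes g :: "real^'n \<Rightarrow> 'c::euclidean_space"
  assumes g: "\<And>s. 0 \<le> s \<Longrightarrow> s \<le> b \<Longrightarrow> ((\<lambda>s. g (R s)) has_vector_derivative \<gamma> s) (at s within {0..b})"
    and \<gamma>: "continuous_on {0..b} \<gamma>" and z: "0 \<le> fst z" "fst z \<le> 1"
  shows "g (u z) = g (R b) + fan_steps1 (\<lambda>s. indicator {0..b} s *\<^sub>R - \<gamma> s) z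
     + fan_steps2 (\<lambda>s. indicator {0..b} s *\<^sub>R - \<gamma> s) z + shock_step (g w - g (R 0)) z"
proof -
  obtain t x where tx: "z = (t, x)" by (cases z)
  with z have t: "0 \<le> t" "t \<le> 1" by auto
  have set1: "{s. clamped_speed s < (e * x - x1) / (t - 2)}
      = {s. 2 * clamped_speed s - x1 < - e * (x - e * clamped_speed s * t)}"
    using t by (auto simp: less_divide_eq algebra_simps ee)
  have 1: "g (Q ((e * x - x1) / (t - 2))) = g (R b) + fan_steps1 (\<lambda>s. indicator {0..b} s *\<^sub>R - \<gamma> s) z"
    unfolding travelling_steps_def tx fst_conv snd_conv set1[symmetric] by (rule fan_superposition[OF g \<gamma>])
  have set2: "{s. clamped_speed s < (e * x - x2) / (t + 1)}
      = {s. x2 + clamped_speed s < e * (x - e * clamped_speed s * t)}"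
    using t by (auto simp: less_divide_eq algebra_simps ee)
  have 2: "g (Q ((e * x - x2) / (t + 1))) = g (R b) + fan_steps2 (\<lambda>s. indicator {0..b} s *\<^sub>R - \<gamma> s) z"
    unfolding travelling_steps_def tx fst_conv snd_conv set2[symmetric] by (rule fan_superposition[OF g \<gamma>])
  show ?thesis
    unfolding shock_step_eq using u_decomposition[OF t, of g x] 1 2 tx by simp
qed

lemma integrable_fan_density:
  fixes \<gamma> :: "real \<Rightarrow> 'c::euclidean_space"
  assumes "continuous_on {0..b} \<gamma>"
  shows "integrable lborel (\<lambda>s. indicator {0..b} s *\<^sub>R - \<gamma> s)"
    "integrable lborel (\<lambda>s. (e * clamped_speed s) *\<^sub>R (indicator {0..b} s *\<^sub>R - \<gamma> s))"
proof -
  show "integrable lborel (\<lambda>s. indicator {0..b} s *\<^sub>R - \<gamma> s)"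
    by (intro borel_integrable_compact continuous_intros assms) simp
  have "integrable lborel (\<lambda>s. indicator {0..b} s *\<^sub>R - ((e * l s) *\<^sub>R \<gamma> s))"
    by (intro borel_integrable_compact continuous_intros assms l_cont) simp
  also have "(\<lambda>s. indicator {0..b} s *\<^sub>R - ((e * l s) *\<^sub>R \<gamma> s))
     = (\<lambda>s. (e * clamped_speed s) *\<^sub>R (indicator {0..b} s *\<^sub>R - \<gamma> s))"
    by (auto simp: fun_eq_iff indicator_def clamped_speed_eq)
  finally show "integrable lborel (\<lambda>s. (e * clamped_speed s) *\<^sub>R (indicator {0..b} s *\<^sub>R - \<gamma> s))" .
qed

lemma integrable_shock_density:
  fixes c :: "'c::euclidean_space"
  shows "integrable lborel (\<lambda>s. indicator {0..1::real} s *\<^sub>R c)"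
  by (intro borel_integrable_compact continuous_intros) simp

text \<open>In the fans the change of G is speed times the change of g, as for a conserved quantity.
  Across the shock it may differ; the subtracted term is the Rankine-Hugoniot defect, placed ahead
  of the front. It vanishes for the state with flux f, and for \<open>eta\<close> with flux q it is
  the entropy production.\<close>

lemma u_weak_pair:
  fixes g G :: "real^'n \<Rightarrow> 'c::euclidean_space"
  assumes g: "\<And>s. 0 \<le> s \<Longrightarrow> s \<le> b \<Longrightarrow> ((\<lambda>s. g (R s)) has_vector_derivative \<gamma> s) (at s within {0..b})"
    and G: "\<And>s. 0 \<le> s \<Longrightarrow> s \<le> b \<Longrightarrow>
      ((\<lambda>s. G (R s)) has_vector_derivative (e * l s) *\<^sub>R \<gamma> s) (at s within {0..b})"
    and \<gamma>: "continuous_on {0..b} \<gamma>"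
  shows "weak_pair 1 (\<lambda>z. g (u z))
     (\<lambda>z. G (u z) - indicator front z *\<^sub>R (G w - G (R 0) - \<sigma> *\<^sub>R (g w - g (R 0))))"
proof -
  let ?\<alpha> = "\<lambda>s. indicator {0..b} s *\<^sub>R - \<gamma> s"
  let ?\<beta> = "\<lambda>s. (e * clamped_speed s) *\<^sub>R ?\<alpha> s"
  have \<beta>: "?\<beta> = (\<lambda>s. indicator {0..b} s *\<^sub>R - ((e * l s) *\<^sub>R \<gamma> s))"
    by (auto simp: fun_eq_iff indicator_def clamped_speed_eq)
  have c: "continuous_on {0..b} (\<lambda>s. (e * l s) *\<^sub>R \<gamma> s)"
    by (intro continuous_intros l_cont \<gamma>)
  have s: "\<sigma> *\<^sub>R (indicator {0..1::real} s *\<^sub>R (g w - g (R 0)))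
      = indicator {0..1} s *\<^sub>R (\<sigma> *\<^sub>R (g w - g (R 0)))" for s
    by simp
  note I = integrable_fan_density[OF \<gamma>]
  have 1: "weak_pair 1 (fan_steps1 ?\<alpha>) (fan_steps1 ?\<beta>)"
    by (rule weak_pair_travelling_steps) (use I in auto)
  have 2: "weak_pair 1 (fan_steps2 ?\<alpha>) (fan_steps2 ?\<beta>)"
    by (rule weak_pair_travelling_steps) (use I in auto)
  have 3: "weak_pair 1 (shock_step (g w - g (R 0))) (shock_step (\<sigma> *\<^sub>R (g w - g (R 0))))"
    unfolding s[symmetric]
    by (rule weak_pair_travelling_steps)
       (use integrable_shock_density[of "g w - g (R 0)"] in \<open>auto simp del: scaleR_scaleR\<close>)
  have 0: "weak_pair 1 (\<lambda>_. g (R b)) (\<lambda>_. G (R b))"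
    by (rule weak_pair_const) simp
  show ?thesis
  proof (rule weak_pair_cong[OF weak_pair_add[OF weak_pair_add[OF weak_pair_add[OF 0 1] 2] 3]])
    fix z :: "real \<times> real" assume z: "0 \<le> fst z" "fst z < 1"
    then have z': "fst z \<le> 1" by simp
    show "g (R b) + fan_steps1 ?\<alpha> z + fan_steps2 ?\<alpha> z + shock_step (g w - g (R 0)) z = g (u z)"
      using u_superposition[OF g \<gamma> z(1) z'] by simp
    show "G (R b) + fan_steps1 ?\<beta> z + fan_steps2 ?\<beta> z + shock_step (\<sigma> *\<^sub>R (g w - g (R 0))) z
      = G (u z) - indicator front z *\<^sub>R (G w - G (R 0) - \<sigma> *\<^sub>R (g w - g (R 0)))"
      unfolding \<beta> shock_step_eq using u_superposition[OF G c z(1) z', unfolded shock_step_eq]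
      by (simp add: algebra_simps)
  qed simp
qed

lemma u_bounded_divergence:
  fixes g :: "real^'n \<Rightarrow> real"
  assumes g: "\<And>s. 0 \<le> s \<Longrightarrow> s \<le> b \<Longrightarrow> ((\<lambda>s. g (R s)) has_vector_derivative \<gamma> s) (at s within {0..b})"
    and \<gamma>: "continuous_on {0..b} \<gamma>"
  shows "bounded_divergence 1 (\<lambda>z. g (u z))"
proof -
  let ?\<alpha> = "\<lambda>s. indicator {0..b} s *\<^sub>R - \<gamma> s"
  note I = integrable_fan_density[OF \<gamma>]
  have 1: "bounded_divergence 1 (fan_steps1 ?\<alpha>)"
    by (rule bounded_divergence_travelling_steps) (use I e in auto)
  have 2: "bounded_divergence 1 (fan_steps2 ?\<alpha>)"
    by (rule bounded_divergence_travelling_steps) (use I e in auto)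
  have 3: "bounded_divergence 1 (shock_step (g w - g (R 0)))"
    by (rule bounded_divergence_travelling_steps)
       (use integrable_shock_density[of "g w - g (R 0)"] e in auto)
  have 0: "bounded_divergence 1 (\<lambda>_. g (R b))"
    by (rule bounded_divergence_const) simp
  show ?thesis
  proof (rule bounded_divergence_cong[OF bounded_divergence_add[OF bounded_divergence_add[OF bounded_divergence_add[OF 0 1] 2] 3]])
    fix z :: "real \<times> real" assume "z \<in> strip 1"
    then have z: "0 \<le> fst z" "fst z \<le> 1" by auto
    show "g (R b) + fan_steps1 ?\<alpha> z + fan_steps2 ?\<alpha> z + shock_step (g w - g (R 0)) z = g (u z)"
      using u_superposition[OF g \<gamma> z] by simp
  qed
qed

lemma u_weak_solution:
  assumes R': "\<And>s. 0 \<le> s \<Longrightarrow> s \<le> b \<Longrightarrow> (R has_vector_derivative R' s) (at s within {0..b})"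
    and R'_cont: "continuous_on {0..b} R'"
    and f: "\<And>s. 0 \<le> s \<Longrightarrow> s \<le> b \<Longrightarrow>
      ((\<lambda>s. f (R s)) has_vector_derivative (e * l s) *\<^sub>R R' s) (at s within {0..b})"
    and RH: "f w - f (R 0) = \<sigma> *\<^sub>R (w - R 0)"
  shows "weak_solution f 1 u (\<lambda>x. u (0, x))"
proof -
  have "u \<in> borel_measurable borel"
    using u_observable_measurable[of "\<lambda>v. v"] by simp
  moreover have "weak_pair 1 u (\<lambda>z. f (u z))"
    using u_weak_pair[of "\<lambda>v. v" R' f] R' R'_cont f RH by simp
  ultimately show ?thesis
    unfolding weak_solution_def weak_pair_def by simp
qed

text \<open>Only the shock produces entropy. Its defect D, tested with \<open>dx \<phi>\<close>
  ahead of the front, becomes - e D times the integral of \<phi> along the shock line. The factor e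
  in \<open>diss\<close> is the orientation: for e = -1 the state w lies on the left.\<close>

lemma u_entropy_inequality:
  fixes eta q :: "real^'n \<Rightarrow> real"
  assumes eta: "\<And>s. 0 \<le> s \<Longrightarrow> s \<le> b \<Longrightarrow> ((\<lambda>s. eta (R s)) has_vector_derivative \<gamma> s) (at s within {0..b})"
    and q: "\<And>s. 0 \<le> s \<Longrightarrow> s \<le> b \<Longrightarrow>
      ((\<lambda>s. q (R s)) has_vector_derivative (e * l s) * \<gamma> s) (at s within {0..b})"
    and \<gamma>: "continuous_on {0..b} \<gamma>"
    and diss: "e * (q w - q (R 0) - \<sigma> * (eta w - eta (R 0))) \<le> 0"
    and \<phi>: "C1c \<phi>" "tsupp \<phi> \<subseteq> strip 1" "\<And>z. 0 \<le> \<phi> z"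
  shows "integrable lborel (\<lambda>z. indicator (strip 1) z * (dt \<phi> z * eta (u z) + dx \<phi> z * q (u z)))"
    and "0 \<le> (\<integral>z. indicator (strip 1) z * (dt \<phi> z * eta (u z) + dx \<phi> z * q (u z)) \<partial>lborel)"
proof -
  define D where "D = q w - q (R 0) - \<sigma> * (eta w - eta (R 0))"
  let ?I = "indicator (strip 1) :: real \<times> real \<Rightarrow> real"
  let ?F = "\<lambda>z. ?I z * (dt \<phi> z * eta (u z) + dx \<phi> z * (q (u z) - indicator front z * D))"
  have "weak_pair 1 (\<lambda>z. eta (u z)) (\<lambda>z. q (u z) - indicator front z * D)"
    using u_weak_pair[of eta \<gamma> q] eta q \<gamma> by (simp add: D_def)
  moreover have "C1c \<phi> \<and> tsupp \<phi> \<subseteq> {z. fst z < 1}"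
    using \<phi> by auto
  ultimately have F: "integrable lborel ?F"
    "(\<integral>z. ?F z \<partial>lborel) + (\<integral>x. \<phi> (0, x) * eta (u (0, x)) \<partial>lborel) = 0"
    unfolding weak_pair_def by auto
  have "\<phi> (0, x) = 0" for x
    using \<phi> by (intro C1c_eq_0(1)) auto
  with F(2) have F0: "(\<integral>z. ?F z \<partial>lborel) = 0"
    by simp
  let ?H = "\<lambda>z. ?I z * (indicator {x. x2 + l 0 < e * x} (snd z - \<sigma> * fst z) * dx \<phi> z)"
  have H: "?H z = indicator front z * (?I z * dx \<phi> z)" for z
    by (auto simp: front_def indicator_def)
  have intH: "integrable lborel ?H"
    unfolding H using \<phi>(1)
    by (intro integrable_indicator_mult integrable_strip_mult C1c_integrable) auto
  have eq: "(\<lambda>z. ?I z * (dt \<phi> z * eta (u z) + dx \<phi> z * q (u z))) = (\<lambda>z. ?F z + ?H z * D)"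
    unfolding H by (auto simp: fun_eq_iff algebra_simps)
  show "integrable lborel (\<lambda>z. ?I z * (dt \<phi> z * eta (u z) + dx \<phi> z * q (u z)))"
    unfolding eq using F(1) intH by (intro Bochner_Integration.integrable_add integrable_mult_left)
  have "(\<integral>z. ?I z * (dt \<phi> z * eta (u z) + dx \<phi> z * q (u z)) \<partial>lborel)
      = (\<integral>z. ?F z \<partial>lborel) + (\<integral>z. ?H z * D \<partial>lborel)"
    unfolding eq using F(1) intH by (intro Bochner_Integration.integral_add integrable_mult_left)
  \<comment> \<open>As e * e = 1, the sign can be shared between two factors, both
    nonpositive.\<close>
  also have "\<dots> = (e * D) * (e * (\<integral>z. ?H z \<partial>lborel))"
    unfolding F0 using e by auto
  also have "\<dots> \<ge> 0"
  proof (rule mult_nonpos_nonpos)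
    show "e * D \<le> 0" using diss by (simp add: D_def)
    have "0 \<le> (\<integral>t. indicator {0<..<1} t * \<phi> (t, e * (x2 + l 0) + \<sigma> * t) \<partial>lborel)"
      using \<phi>(3) by (intro integral_nonneg_AE) auto
    then show "e * (\<integral>z. ?H z \<partial>lborel) \<le> 0"
      using dx_half_plane_integral[OF \<phi>(1) e, of 1 "x2 + l 0" \<sigma>] by simp
  qed
  finally show "0 \<le> (\<integral>z. ?I z * (dt \<phi> z * eta (u z) + dx \<phi> z * q (u z)) \<partial>lborel)" .
qed

lemma u_BV_loc:
  assumes R': "\<And>s. 0 \<le> s \<Longrightarrow> s \<le> b \<Longrightarrow> (R has_vector_derivative R' s) (at s within {0..b})"
    and R'_cont: "continuous_on {0..b} R'"
  shows "BV_loc (strip 1) u"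
  unfolding BV_loc_def
proof (intro allI impI conjI)
  fix S :: "(real \<times> real) set"
  assume S: "open S \<and> compact (closure S) \<and> closure S \<subseteq> strip 1"
  then have S1: "S \<subseteq> strip 1" using closure_subset by blast
  have meas: "u \<in> borel_measurable borel"
    using u_observable_measurable[of "\<lambda>v. v"] by simp
  have "compact (insert w (R ` {0..b}))"
    by (intro compact_insert compact_continuous_image R_cont) simp
  then obtain B where B: "\<And>v. v \<in> insert w (R ` {0..b}) \<Longrightarrow> norm v \<le> B"
    using compact_imp_bounded bounded_iff by metis
  show "set_integrable lborel S u"
    unfolding set_integrable_def
  proof (rule integrableI_bounded_set[where A=S and B=B])
    show 1: "S \<in> sets lborel" using S by simp
    show "(\<lambda>x. indicator S x *\<^sub>R u x) \<in> borel_measurable lborel"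
      using meas 1 by (intro borel_measurable_scaleR borel_measurable_indicator) auto
    have "emeasure lborel S \<le> emeasure lborel (closure S)"
      using S by (intro emeasure_mono closure_subset) (auto simp: borel_compact)
    also have "\<dots> < \<infinity>"
      using S emeasure_compact_finite by blast
    finally show "emeasure lborel S < \<infinity>" .
    show "AE x in lborel. x \<in> S \<longrightarrow> norm (indicator S x *\<^sub>R u x) \<le> B"
      using B u_in by (intro AE_I2) auto
  qed simp
  fix j :: 'n
  have "bounded_divergence 1 (\<lambda>z. u z $ j)"
  proof (rule u_bounded_divergence[where \<gamma>="\<lambda>s. R' s $ j"])
    show "((\<lambda>s. R s $ j) has_vector_derivative R' s $ j) (at s within {0..b})" if "0 \<le> s" "s \<le> b" for s
      using bounded_linear.has_vector_derivative[OF bounded_linear_vec_nth R'[OF that]] .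
    show "continuous_on {0..b} (\<lambda>s. R' s $ j)"
      by (intro continuous_intros R'_cont)
  qed
  then obtain M where M: "\<And>\<phi>1 \<phi>2. C1c \<phi>1 \<and> C1c \<phi>2 \<and> tsupp \<phi>1 \<subseteq> strip 1 \<and> tsupp \<phi>2 \<subseteq> strip 1 \<and>
     (\<forall>z. (\<phi>1 z)\<^sup>2 + (\<phi>2 z)\<^sup>2 \<le> 1) \<Longrightarrow>
     (\<integral>z. indicator (strip 1) z * u z $ j * (dt \<phi>1 z + dx \<phi>2 z) \<partial>lborel) \<le> M"
    unfolding bounded_divergence_def by blast
  show "\<exists>M. \<forall>\<phi>1 \<phi>2. C1c \<phi>1 \<and> C1c \<phi>2 \<and> tsupp \<phi>1 \<subseteq> S \<and> tsupp \<phi>2 \<subseteq> S \<and>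
            (\<forall>z. (\<phi>1 z)\<^sup>2 + (\<phi>2 z)\<^sup>2 \<le> 1) \<longrightarrow>
            (\<integral>z. indicator S z * (u z $ j) * (dt \<phi>1 z + dx \<phi>2 z) \<partial>lborel) \<le> M"
  proof (intro exI allI impI)
    fix \<phi>1 \<phi>2 :: "real \<times> real \<Rightarrow> real"
    assume A: "C1c \<phi>1 \<and> C1c \<phi>2 \<and> tsupp \<phi>1 \<subseteq> S \<and> tsupp \<phi>2 \<subseteq> S \<and> (\<forall>z. (\<phi>1 z)\<^sup>2 + (\<phi>2 z)\<^sup>2 \<le> 1)"
    \<comment> \<open>Tests supported in S cannot distinguish S from the strip, so the bound for the
      strip serves every S.\<close>
    have eq: "indicator S z * (u z $ j) * (dt \<phi>1 z + dx \<phi>2 z)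
        = indicator (strip 1) z * u z $ j * (dt \<phi>1 z + dx \<phi>2 z)" for z
    proof (cases "z \<in> S")
      case True
      then show ?thesis using S1 by (auto simp: indicator_def)
    next
      case False
      then have "z \<notin> tsupp \<phi>1" "z \<notin> tsupp \<phi>2" using A by blast+
      then have "dt \<phi>1 z = 0" "dx \<phi>2 z = 0" using A C1c_eq_0 by blast+
      then show ?thesis by simp
    qed
    have "tsupp \<phi>1 \<subseteq> strip 1" "tsupp \<phi>2 \<subseteq> strip 1" using A S1 by blast+
    then show "(\<integral>z. indicator S z * (u z $ j) * (dt \<phi>1 z + dx \<phi>2 z) \<partial>lborel) \<le> M"
      unfolding eq using A by (intro M) blast
  qed
qed

section \<open>Energy on the two sides of a shift\<close>

text \<open>An integral over the speed variable. At time distance \<tau> from its focus a fan is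
  this profile stretched by \<tau> and carries \<tau> times this value: \<tau> is 2 - t for the
  compression and t + 1 for the rarefaction.\<close>

definition fan_integral :: "(real^'n \<Rightarrow> real) \<Rightarrow> real" where
  "fan_integral \<rho> = integral {l b..l 0} (\<lambda>\<xi>. \<rho> (Q \<xi>))"

lemma observable_Q_cont:
  assumes "continuous_on (R ` {0..b}) \<rho>"
  shows "continuous_on S (\<lambda>\<xi>. \<rho> (Q \<xi>))"
  by (rule continuous_on_subset[OF continuous_on_compose2[OF assms Q_cont]]) (use Q_in in auto)

lemma nn_integral_Q:
  assumes \<rho>: "continuous_on (R ` {0..b}) \<rho>" "\<And>v. v \<in> R ` {0..b} \<Longrightarrow> 0 \<le> \<rho> v"
    and \<xi>: "\<xi>0 \<le> l b" "l 0 \<le> \<xi>1"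
  shows "(\<integral>\<^sup>+\<xi>. indicator {\<xi>0..\<xi>1} \<xi> * ennreal (\<rho> (Q \<xi>)) \<partial>lborel)
     = ennreal ((l b - \<xi>0) * \<rho> (R b) + fan_integral \<rho> + (\<xi>1 - l 0) * \<rho> (R 0))"
proof -
  have c: "continuous_on S (\<lambda>\<xi>. \<rho> (Q \<xi>))" for S
    by (rule observable_Q_cont[OF \<rho>(1)])
  have int: "(\<lambda>\<xi>. \<rho> (Q \<xi>)) integrable_on {c..d}" for c d
    using integrable_continuous_interval[OF c] .
  have "integral {\<xi>0..\<xi>1} (\<lambda>\<xi>. \<rho> (Q \<xi>))
     = integral {\<xi>0..l b} (\<lambda>\<xi>. \<rho> (Q \<xi>)) + integral {l b..l 0} (\<lambda>\<xi>. \<rho> (Q \<xi>)) + integral {l 0..\<xi>1} (\<lambda>\<xi>. \<rho> (Q \<xi>))"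
    using Henstock_Kurzweil_Integration.integral_combine[of \<xi>0 "l b" "l 0" "\<lambda>\<xi>. \<rho> (Q \<xi>)"]
      Henstock_Kurzweil_Integration.integral_combine[of \<xi>0 "l 0" \<xi>1 "\<lambda>\<xi>. \<rho> (Q \<xi>)"] int \<xi> l_b_less by simp
  moreover have "integral {\<xi>0..l b} (\<lambda>\<xi>. \<rho> (Q \<xi>)) = integral {\<xi>0..l b} (\<lambda>\<xi>. \<rho> (R b))"
    by (rule integral_cong) (simp add: Q_low)
  moreover have "integral {l 0..\<xi>1} (\<lambda>\<xi>. \<rho> (Q \<xi>)) = integral {l 0..\<xi>1} (\<lambda>\<xi>. \<rho> (R 0))"
    by (rule integral_cong) (simp add: Q_high)
  ultimately have "integral {\<xi>0..\<xi>1} (\<lambda>\<xi>. \<rho> (Q \<xi>))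
     = (l b - \<xi>0) * \<rho> (R b) + fan_integral \<rho> + (\<xi>1 - l 0) * \<rho> (R 0)"
    using \<xi> by (simp add: fan_integral_def)
  moreover have "(\<integral>\<^sup>+\<xi>. ennreal (\<rho> (Q \<xi>)) * indicator {\<xi>0..\<xi>1} \<xi> \<partial>lborel)
      = ennreal (integral {\<xi>0..\<xi>1} (\<lambda>\<xi>. \<rho> (Q \<xi>)))"
    using \<rho>(2) Q_in int by (intro nn_integral_has_integral_lebesgue' integrable_integral) auto
  ultimately show ?thesis by (simp add: mult.commute)
qed

lemma u_line_measurable:
  fixes \<rho> :: "real^'n \<Rightarrow> real"
  assumes "continuous_on (R ` {0..b}) \<rho>"
  shows "(\<lambda>y. \<rho> (u (t, e * y))) \<in> borel_measurable borel"
proof (rule measurable_compose[OF _ u_observable_measurable[OF assms]])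
  show "(\<lambda>y. (t, e * y)) \<in> borel_measurable borel"
    by (intro borel_measurable_continuous_onI continuous_intros)
qed

text \<open>The substitution y = x1 + (t - 2) \<xi> turns the slice into the fixed profile Q and
  reverses orientation, so y \<le> h becomes \<open>\<xi>0\<close> \<le> \<xi>. Beyond l 0 the state
  is R 0 with \<rho> = 0, so the half-line integral is finite; the plateau leaves a term linear in
  h.\<close>

lemma energy_left:
  assumes \<rho>: "continuous_on (R ` {0..b}) \<rho>" "\<And>v. v \<in> R ` {0..b} \<Longrightarrow> 0 \<le> \<rho> v" "\<rho> (R 0) = 0"
    and t: "0 \<le> t" "t \<le> 1" and h: "\<bar>h\<bar> \<le> C"
  shows "(\<integral>\<^sup>+y. indicator {..h} y * ennreal (\<rho> (u (t, e * y))) \<partial>lborel)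
     = ennreal (((2 - t) * l b - x1 + h) * \<rho> (R b) + (2 - t) * fan_integral \<rho>)"
proof -
  note [measurable] = u_line_measurable[OF \<rho>(1)]
  define \<xi>0 where "\<xi>0 = (h - x1) / (t - 2)"
  have \<xi>0: "\<xi>0 \<le> l b"
    unfolding \<xi>0_def using h by (intro compression_low t) auto
  have u: "u (t, e * y) = Q ((y - x1) / (t - 2))" if "y \<le> h" for y
  proof -
    have y: "y \<le> C" using that h by linarith
    have "(t, e * y) \<notin> front"
      using front_far[OF t] y by (simp add: front_iff ee)
    then show ?thesis
      using Q_low[OF compression_low[OF t, of y]] Q_low[OF rarefaction_low[OF t y]] C
      by (auto simp: u_def ee)
  qed
  have "(\<integral>\<^sup>+y. indicator {..h} y * ennreal (\<rho> (u (t, e * y))) \<partial>lborel)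
    = \<bar>t - 2\<bar> * (\<integral>\<^sup>+\<xi>. indicator {..h} (x1 + (t - 2) * \<xi>) * ennreal (\<rho> (u (t, e * (x1 + (t - 2) * \<xi>)))) \<partial>lborel)"
    by (rule nn_integral_real_affine) (use t in auto)
  also have "(\<integral>\<^sup>+\<xi>. indicator {..h} (x1 + (t - 2) * \<xi>) * ennreal (\<rho> (u (t, e * (x1 + (t - 2) * \<xi>)))) \<partial>lborel)
     = (\<integral>\<^sup>+\<xi>. indicator {\<xi>0..l 0} \<xi> * ennreal (\<rho> (Q \<xi>)) \<partial>lborel)"
  proof (rule nn_integral_cong)
    fix \<xi> :: real
    have iff: "x1 + (t - 2) * \<xi> \<le> h \<longleftrightarrow> \<xi>0 \<le> \<xi>"
      using t by (simp add: \<xi>0_def divide_le_eq algebra_simps)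
    have "u (t, e * (x1 + (t - 2) * \<xi>)) = Q \<xi>" if "x1 + (t - 2) * \<xi> \<le> h"
      using u[OF that] t by simp
    moreover have "\<rho> (Q \<xi>) = 0" if "l 0 < \<xi>"
      using that by (simp add: Q_high \<rho>(3))
    ultimately show "indicator {..h} (x1 + (t - 2) * \<xi>) * ennreal (\<rho> (u (t, e * (x1 + (t - 2) * \<xi>))))
      = indicator {\<xi>0..l 0} \<xi> * ennreal (\<rho> (Q \<xi>))"
      using iff by (auto simp: indicator_def)
  qed
  also have "\<dots> = ennreal ((l b - \<xi>0) * \<rho> (R b) + fan_integral \<rho>)"
    using nn_integral_Q[OF \<rho>(1,2) \<xi>0 order_refl] by simp
  also have "ennreal \<bar>t - 2\<bar> * \<dots> = ennreal (\<bar>t - 2\<bar> * ((l b - \<xi>0) * \<rho> (R b) + fan_integral \<rho>))"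
    by (rule ennreal_mult''[symmetric])
       (use \<xi>0 \<rho> b Q_in in \<open>auto simp: fan_integral_def intro!: add_nonneg_nonneg mult_nonneg_nonneg integral_nonneg integrable_continuous_interval observable_Q_cont\<close>)
  also have "\<bar>t - 2\<bar> * ((l b - \<xi>0) * \<rho> (R b) + fan_integral \<rho>)
     = ((2 - t) * l b - x1 + h) * \<rho> (R b) + (2 - t) * fan_integral \<rho>"
  proof -
    have "(2 - t) * \<xi>0 = x1 - h"
      using t by (simp add: \<xi>0_def field_simps)
    then have "(2 - t) * (l b - \<xi>0) = (2 - t) * l b - x1 + h"
      by (simp add: right_diff_distrib)
    moreover have "\<bar>t - 2\<bar> = 2 - t" using t by simp
    ultimately show ?thesis by (simp only: distrib_left mult.assoc[symmetric])
  qed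
  finally show ?thesis .
qed

text \<open>In the variable \<xi> with y = x2 + (t + 1) \<xi> the shock sits at
  \<open>\<xi>1\<close>, and ahead of it \<rho>' vanishes. Between the fast edge and the shock the
  state is R 0 on a stretch of length t (e \<sigma> - l 0), the source of the last term.\<close>

lemma energy_right:
  assumes \<rho>: "continuous_on (R ` {0..b}) \<rho>" "\<And>v. v \<in> R ` {0..b} \<Longrightarrow> 0 \<le> \<rho> v" "\<rho> w = 0"
    and t: "0 \<le> t" "t \<le> 1" and h: "\<bar>h\<bar> \<le> C"
  shows "(\<integral>\<^sup>+y. indicator {h..} y * ennreal (\<rho> (u (t, e * y))) \<partial>lborel)
     = ennreal ((x2 + (t + 1) * l b - h) * \<rho> (R b) + (t + 1) * fan_integral \<rho>
          + t * (e * \<sigma> - l 0) * \<rho> (R 0))"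
proof -
  note [measurable] = u_line_measurable[OF \<rho>(1)]
  define \<xi>0 where "\<xi>0 = (h - x2) / (t + 1)"
  define \<xi>1 where "\<xi>1 = (l 0 + e * \<sigma> * t) / (t + 1)"
  have \<xi>0: "\<xi>0 \<le> l b"
    unfolding \<xi>0_def using h by (intro rarefaction_low t) auto
  have \<xi>1: "l 0 \<le> \<xi>1"
    using rarefaction_high[OF t, of "x2 + l 0 + e * \<sigma> * t"] by (simp add: \<xi>1_def)
  have u: "u (t, e * y) = Q ((y - x2) / (t + 1))" if "h \<le> y" "y \<le> x2 + l 0 + e * \<sigma> * t" for y
  proof -
    have y: "- C \<le> y" using that h by linarith
    have "(t, e * y) \<notin> front"
      using that by (simp add: front_iff ee)
    then show ?thesis
      using Q_low[OF compression_low[OF t y]] Q_low[OF rarefaction_low[OF t, of y]] C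
      by (auto simp: u_def ee)
  qed
  have "(\<integral>\<^sup>+y. indicator {h..} y * ennreal (\<rho> (u (t, e * y))) \<partial>lborel)
    = \<bar>t + 1\<bar> * (\<integral>\<^sup>+\<xi>. indicator {h..} (x2 + (t + 1) * \<xi>) * ennreal (\<rho> (u (t, e * (x2 + (t + 1) * \<xi>)))) \<partial>lborel)"
    by (rule nn_integral_real_affine) (use t in auto)
  also have "(\<integral>\<^sup>+\<xi>. indicator {h..} (x2 + (t + 1) * \<xi>) * ennreal (\<rho> (u (t, e * (x2 + (t + 1) * \<xi>)))) \<partial>lborel)
     = (\<integral>\<^sup>+\<xi>. indicator {\<xi>0..\<xi>1} \<xi> * ennreal (\<rho> (Q \<xi>)) \<partial>lborel)"
  proof (rule nn_integral_cong)
    fix \<xi> :: real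
    have iff: "h \<le> x2 + (t + 1) * \<xi> \<longleftrightarrow> \<xi>0 \<le> \<xi>"
      using t by (simp add: \<xi>0_def divide_le_eq algebra_simps)
    have iff1: "x2 + (t + 1) * \<xi> \<le> x2 + l 0 + e * \<sigma> * t \<longleftrightarrow> \<xi> \<le> \<xi>1"
      using t by (simp add: \<xi>1_def le_divide_eq algebra_simps)
    have "u (t, e * (x2 + (t + 1) * \<xi>)) = Q \<xi>"
      if "h \<le> x2 + (t + 1) * \<xi>" "x2 + (t + 1) * \<xi> \<le> x2 + l 0 + e * \<sigma> * t"
      using u[OF that] t by simp
    moreover have "u (t, e * (x2 + (t + 1) * \<xi>)) = w"
      if "\<not> x2 + (t + 1) * \<xi> \<le> x2 + l 0 + e * \<sigma> * t"
    proof -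
      have "(t, e * (x2 + (t + 1) * \<xi>)) \<in> front"
        unfolding front_iff ee using that by linarith
      then show ?thesis by (simp add: u_def)
    qed
    ultimately show "indicator {h..} (x2 + (t + 1) * \<xi>) * ennreal (\<rho> (u (t, e * (x2 + (t + 1) * \<xi>))))
      = indicator {\<xi>0..\<xi>1} \<xi> * ennreal (\<rho> (Q \<xi>))"
      unfolding iff iff1 using iff \<rho>(3)
      by (cases "\<xi>0 \<le> \<xi>"; cases "\<xi> \<le> \<xi>1") (simp_all add: indicator_def)
  qed
  also have "\<dots> = ennreal ((l b - \<xi>0) * \<rho> (R b) + fan_integral \<rho> + (\<xi>1 - l 0) * \<rho> (R 0))"
    by (rule nn_integral_Q[OF \<rho>(1,2) \<xi>0 \<xi>1])
  also have "ennreal \<bar>t + 1\<bar> * \<dots>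
     = ennreal (\<bar>t + 1\<bar> * ((l b - \<xi>0) * \<rho> (R b) + fan_integral \<rho> + (\<xi>1 - l 0) * \<rho> (R 0)))"
    by (rule ennreal_mult''[symmetric])
       (use \<xi>0 \<xi>1 \<rho> b Q_in in \<open>auto simp: fan_integral_def intro!: add_nonneg_nonneg mult_nonneg_nonneg integral_nonneg integrable_continuous_interval observable_Q_cont\<close>)
  also have "\<bar>t + 1\<bar> * ((l b - \<xi>0) * \<rho> (R b) + fan_integral \<rho> + (\<xi>1 - l 0) * \<rho> (R 0))
     = (x2 + (t + 1) * l b - h) * \<rho> (R b) + (t + 1) * fan_integral \<rho> + t * (e * \<sigma> - l 0) * \<rho> (R 0)"
  proof -
    have "(t + 1) * \<xi>0 = h - x2" "(t + 1) * \<xi>1 = l 0 + e * \<sigma> * t"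
      using t by (simp_all add: \<xi>0_def \<xi>1_def)
    then have "(t + 1) * (l b - \<xi>0) = x2 + (t + 1) * l b - h"
      "(t + 1) * (\<xi>1 - l 0) = t * (e * \<sigma> - l 0)"
      by (simp_all only: right_diff_distrib) (simp_all add: algebra_simps)
    moreover have "\<bar>t + 1\<bar> = t + 1" using t by simp
    ultimately show ?thesis by (simp only: distrib_left mult.assoc[symmetric])
  qed
  finally show ?thesis .
qed

text \<open>Because the state R b around the origin has equal weighted energies, the position h drops out.\<close>

lemma energy_affine:
  assumes \<rho>: "continuous_on (R ` {0..b}) \<rho>" "\<And>v. v \<in> R ` {0..b} \<Longrightarrow> 0 \<le> \<rho> v" "\<rho> (R 0) = 0"
    and \<rho>': "continuous_on (R ` {0..b}) \<rho>'" "\<And>v. v \<in> R ` {0..b} \<Longrightarrow> 0 \<le> \<rho>' v" "\<rho>' w = 0"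
    and c: "0 < c" "0 < c'" "c * \<rho> (R b) = c' * \<rho>' (R b)"
    and neg: "\<And>s. 0 \<le> s \<Longrightarrow> s < b \<Longrightarrow> c * \<rho> (R s) < c' * \<rho>' (R s)"
  obtains K G where "0 \<le> K" "0 < G"
    "\<And>t h. 0 \<le> t \<Longrightarrow> t \<le> 1 \<Longrightarrow> \<bar>h\<bar> \<le> C \<Longrightarrow>
      ennreal c * (\<integral>\<^sup>+y. indicator {..h} y * ennreal (\<rho> (u (t, e * y))) \<partial>lborel)
      + ennreal c' * (\<integral>\<^sup>+y. indicator {h..} y * ennreal (\<rho>' (u (t, e * y))) \<partial>lborel) = ennreal (K + t * G)"
proof -
  define \<kappa> where "\<kappa> = c * \<rho> (R b)"
  have \<kappa>': "c' * \<rho>' (R b) = \<kappa>" using c(3) by (simp add: \<kappa>_def)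
  \<comment> \<open>The factor 3 is (2 - t) + (t + 1), the trace of the two plateau edges moving
    with the common speed l b.\<close>
  define K where "K = \<kappa> * (3 * l b - x1 + x2) + 2 * c * fan_integral \<rho> + c' * fan_integral \<rho>'"
  \<comment> \<open>Growth of the rarefaction minus loss of the compression, plus the gap that opens
    between fan and shock.\<close>
  define G where "G = c' * fan_integral \<rho>' - c * fan_integral \<rho> + c' * (e * \<sigma> - l 0) * \<rho>' (R 0)"
  have inR: "R b \<in> R ` {0..b}" "R 0 \<in> R ` {0..b}" using b by auto
  have int: "(\<lambda>\<xi>. \<rho> (Q \<xi>)) integrable_on {l b..l 0}" "(\<lambda>\<xi>. \<rho>' (Q \<xi>)) integrable_on {l b..l 0}"
    using \<rho>(1) \<rho>'(1) by (auto intro!: integrable_continuous_interval observable_Q_cont)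
  have \<Gamma>: "0 \<le> fan_integral \<rho>" "0 \<le> fan_integral \<rho>'"
    unfolding fan_integral_def using int \<rho>(2) \<rho>'(2) Q_in by (auto intro!: integral_nonneg)
  have coeff1: "0 \<le> (2 - t) * l b - x1 + h" if "0 \<le> t" "t \<le> 1" "\<bar>h\<bar> \<le> C" for t h
    using compression_low[of t h] that by (simp add: divide_le_eq algebra_simps)
  have coeff2: "0 \<le> x2 + (t + 1) * l b - h" if "0 \<le> t" "t \<le> 1" "\<bar>h\<bar> \<le> C" for t h
    using rarefaction_low[of t h] that by (simp add: divide_le_eq algebra_simps)
  have "0 \<le> 3 * l b - x1 + x2"
    using coeff1[of 0 0] coeff2[of 0 0] C by simp
  moreover have "0 \<le> \<kappa>"
    unfolding \<kappa>_def using c(1) \<rho>(2)[OF inR(1)] by simp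
  ultimately have K: "0 \<le> K"
    unfolding K_def using c(1,2) \<Gamma> by simp
  let ?d = "\<lambda>\<xi>. c' * \<rho>' (Q \<xi>) - c * \<rho> (Q \<xi>)"
  have "c * \<rho> (R s) \<le> c' * \<rho>' (R s)" if "0 \<le> s" "s \<le> b" for s
    using neg[OF that(1)] that(2) c(3) by (cases "s = b") auto
  then have d_nonneg: "0 \<le> ?d \<xi>" for \<xi>
    using W_in[of \<xi>] by (simp add: Q_def)
  have d_cont: "continuous_on {l b..l 0} ?d"
    by (intro continuous_intros observable_Q_cont \<rho>(1) \<rho>'(1))
  \<comment> \<open>At \<xi> = l 0 the state is R 0, where \<open>neg\<close> applies because b is
    positive; one positive value of a continuous nonnegative function on a nondegenerate interval
    makes its integral positive.\<close>
  have "?d (l 0) > 0"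
    using neg[of 0] b by (simp add: Q_high)
  then have "integral {l b..l 0} ?d \<noteq> 0"
    using integral_eq_0_iff[OF d_cont l_b_less d_nonneg] l_b_less by force
  moreover have "0 \<le> integral {l b..l 0} ?d"
    using d_nonneg d_cont by (intro integral_nonneg integrable_continuous_interval)
  moreover have "integral {l b..l 0} ?d = c' * fan_integral \<rho>' - c * fan_integral \<rho>"
    unfolding fan_integral_def
    by (subst Henstock_Kurzweil_Integration.integral_diff)
       (auto intro!: integrable_continuous_interval continuous_intros observable_Q_cont \<rho>(1) \<rho>'(1))
  moreover have "0 \<le> c' * (e * \<sigma> - l 0) * \<rho>' (R 0)"
    using c lax \<rho>'(2)[OF inR(2)] by simp
  ultimately have G: "0 < G"
    unfolding G_def by linarith
  show ?thesis
  proof (rule that[OF K G])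
    fix t h :: real assume th: "0 \<le> t" "t \<le> 1" "\<bar>h\<bar> \<le> C"
    let ?L = "((2 - t) * l b - x1 + h) * \<rho> (R b) + (2 - t) * fan_integral \<rho>"
    let ?R = "(x2 + (t + 1) * l b - h) * \<rho>' (R b) + (t + 1) * fan_integral \<rho>'
          + t * (e * \<sigma> - l 0) * \<rho>' (R 0)"
    have L0: "0 \<le> ?L"
      using coeff1[OF th] \<Gamma> th \<rho>(2)[OF inR(1)] by simp
    have R0: "0 \<le> ?R"
      using coeff2[OF th] \<Gamma> th \<rho>'(2)[OF inR(1)] \<rho>'(2)[OF inR(2)] lax by simp
    have "c * ?L = ((2 - t) * l b - x1 + h) * \<kappa> + (2 - t) * c * fan_integral \<rho>"
      by (simp add: \<kappa>_def algebra_simps)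
    moreover have "c' * ?R = (x2 + (t + 1) * l b - h) * \<kappa> + (t + 1) * c' * fan_integral \<rho>'
          + t * (c' * (e * \<sigma> - l 0) * \<rho>' (R 0))"
      unfolding \<kappa>'[symmetric] by (simp add: algebra_simps)
    ultimately have sum: "c * ?L + c' * ?R = K + t * G"
      by (simp add: K_def G_def algebra_simps)
    show "ennreal c * (\<integral>\<^sup>+y. indicator {..h} y * ennreal (\<rho> (u (t, e * y))) \<partial>lborel)
      + ennreal c' * (\<integral>\<^sup>+y. indicator {h..} y * ennreal (\<rho>' (u (t, e * y))) \<partial>lborel) = ennreal (K + t * G)"
      using energy_left[OF \<rho> th] energy_right[OF \<rho>' th] L0 R0 c(1,2)
      by (simp add: ennreal_mult' ennreal_plus flip: sum)
  qed
qed

end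

section \<open>Failure of the contraction\<close>

lemma convex_on_ge_tangent:
  fixes eta :: "'v::real_inner \<Rightarrow> real"
  assumes cv: "convex_on V eta" and V: "u \<in> V" "v \<in> V"
    and d: "(eta has_derivative (\<lambda>h. g \<bullet> h)) (at v)"
  shows "eta v + g \<bullet> (u - v) \<le> eta u"
proof -
  define \<psi> where "\<psi> t = eta (v + t *\<^sub>R (u - v))" for t :: real
  have "((\<lambda>t. v + t *\<^sub>R (u - v)) has_derivative (\<lambda>t. t *\<^sub>R (u - v))) (at 0)"
    by (auto intro!: derivative_eq_intros)
  moreover have "(eta has_derivative (\<lambda>h. g \<bullet> h)) (at (v + 0 *\<^sub>R (u - v)))"
    using d by simp
  ultimately have "(\<psi> has_derivative (\<lambda>t. g \<bullet> (t *\<^sub>R (u - v)))) (at 0)"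
    unfolding \<psi>_def by (rule has_derivative_compose)
  then have "(\<psi> has_real_derivative g \<bullet> (u - v)) (at 0)"
    by (simp add: has_field_derivative_def mult.commute[of _ "g \<bullet> (u - v)"])
  then have lim: "((\<lambda>t. (\<psi> t - \<psi> 0) / (t - 0)) \<longlongrightarrow> g \<bullet> (u - v)) (at_right 0)"
    unfolding has_field_derivative_iff using tendsto_mono[OF at_le] by (metis subset_UNIV)
  have "(\<psi> t - \<psi> 0) / (t - 0) \<le> eta u - eta v" if "0 < t" "t < 1" for t
  proof -
    have "eta ((1 - t) *\<^sub>R v + t *\<^sub>R u) \<le> (1 - t) * eta v + t * eta u"
      using convex_onD[OF cv, of t v u] that V by simp
    moreover have "(1 - t) *\<^sub>R v + t *\<^sub>R u = v + t *\<^sub>R (u - v)"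
      by (simp add: algebra_simps)
    ultimately have "\<psi> t - \<psi> 0 \<le> (eta u - eta v) * t"
      by (simp add: \<psi>_def algebra_simps)
    then show ?thesis
      using that by (simp add: pos_divide_le_eq)
  qed
  then have "\<forall>\<^sub>F t in at_right 0. (\<psi> t - \<psi> 0) / (t - 0) \<le> eta u - eta v"
    unfolding eventually_at_right_field by (intro exI[of _ 1]) auto
  from tendsto_upperbound[OF lim this] show ?thesis
    by (simp add: trivial_limit_at_right_real)
qed

lemma strictly_convex_on_imp_convex_on:
  assumes "strictly_convex_on V eta" "convex V"
  shows "convex_on V eta"
proof (rule convex_onI[OF _ assms(2)])
  fix t :: real and x y assume "0 < t" "t < 1" "x \<in> V" "y \<in> V"
  then show "eta ((1 - t) *\<^sub>R x + t *\<^sub>R y) \<le> (1 - t) * eta x + t * eta y"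
  proof (cases "x = y")
    case False
    with \<open>0 < t\<close> \<open>t < 1\<close> \<open>x \<in> V\<close> \<open>y \<in> V\<close> show ?thesis
      using assms(1)[unfolded strictly_convex_on_def, rule_format, of x y "1 - t"] by simp
  qed (simp add: algebra_simps flip: scaleR_add_left)
qed

lemma rel_eta_pos:
  assumes sc: "strictly_convex_on V eta" and V: "convex V" "u \<in> V" "v \<in> V"
    and d: "(eta has_derivative (\<lambda>h. Deta v \<bullet> h)) (at v)"
  shows "0 \<le> rel_eta eta Deta u v" "u \<noteq> v \<Longrightarrow> 0 < rel_eta eta Deta u v"
proof -
  note cv = strictly_convex_on_imp_convex_on[OF sc V(1)]
  show "0 \<le> rel_eta eta Deta u v"
    using convex_on_ge_tangent[OF cv V(2,3) d] by (simp add: rel_eta_def)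
  assume "u \<noteq> v"
  \<comment> \<open>The tangent at v lies below \<open>eta\<close> at the midpoint, and
    \<open>eta\<close> there lies strictly below the chord; together they give strictness at
    u.\<close>
  let ?m = "(1/2) *\<^sub>R u + (1 - 1/2) *\<^sub>R v"
  have "eta ?m < 1/2 * eta u + (1 - 1/2) * eta v"
    using sc[unfolded strictly_convex_on_def, rule_format, of u v "1/2"] V \<open>u \<noteq> v\<close> by simp
  moreover have "?m \<in> V"
    using V by (intro convexD) auto
  then have "eta v + Deta v \<bullet> (?m - v) \<le> eta ?m"
    by (rule convex_on_ge_tangent[OF cv _ V(3) d])
  moreover have "?m - v = (1/2) *\<^sub>R (u - v)"
    by (simp only: scaleR_diff_left scaleR_diff_right scaleR_one) simp
  ultimately show "0 < rel_eta eta Deta u v"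
    by (simp add: rel_eta_def)
qed

text \<open>\<open>C2_on\<close> only provides some derivative with the required smoothness;
  uniqueness of the derivative identifies it with the given gradient, whose components are its
  values on the basis.\<close>

lemma C2_on_gradient_continuous:
  fixes eta :: "'v::euclidean_space \<Rightarrow> real"
  assumes "C2_on V eta" and d: "\<And>u. u \<in> V \<Longrightarrow> (eta has_derivative (\<lambda>h. Deta u \<bullet> h)) (at u)"
  shows "continuous_on V Deta"
proof -
  obtain Dg :: "'v \<Rightarrow> 'v \<Rightarrow>\<^sub>L real" and D2g where
    Dg: "\<And>u. u \<in> V \<Longrightarrow> (eta has_derivative blinfun_apply (Dg u)) (at u)"
      "\<And>u. u \<in> V \<Longrightarrow> (Dg has_derivative blinfun_apply (D2g u)) (at u)"
    using assms(1) unfolding C2_on_def by blast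
  have "continuous_on V Dg"
    using Dg(2) has_derivative_continuous continuous_at_imp_continuous_on by blast
  then have "continuous_on V (\<lambda>u. \<Sum>i\<in>Basis. Dg u i *\<^sub>R i)"
    by (intro continuous_on_sum continuous_on_scaleR blinfun.continuous_on continuous_on_const)
  moreover have "Deta u = (\<Sum>i\<in>Basis. Dg u i *\<^sub>R i)" if "u \<in> V" for u
  proof -
    have "Dg u h = Deta u \<bullet> h" for h
      using has_derivative_unique[OF Dg(1)[OF that] d[OF that]] by metis
    then show ?thesis by (simp add: euclidean_representation)
  qed
  ultimately show ?thesis
    by (simp cong: continuous_on_cong)
qed

lemma subset_Ucl: "V \<subseteq> Ucl V eta"
proof
  fix v assume "v \<in> V"
  then show "v \<in> Ucl V eta"
    unfolding Ucl_def by (intro CollectI exI[of _ "\<lambda>_. v"]) auto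
qed

section \<open>Rarefaction curves\<close>

text \<open>Genuine nonlinearity makes the derivative of the speed along R nonzero but not
  continuous, so a constant sign cannot be inferred by the intermediate value theorem. Rolle's
  theorem gives injectivity on [0, t], hence monotonicity, and the comparison with the starting
  value fixes the direction.\<close>

lemma rarefaction_curve_speed_strict_mono:
  assumes R: "rarefaction_curve V lam r j p R"
    and dec: "\<And>s. 0 < s \<Longrightarrow> e * lam j (R s) < e * lam j p" and st: "0 \<le> s" "s < t"
  shows "e * lam j (R t) < e * lam j (R s)"
proof -
  let ?l = "\<lambda>s. e * lam j (R s)"
  have R0: "R 0 = p" using R by (simp add: rarefaction_curve_def)
  have "\<exists>D. (?l has_real_derivative D) (at x within {0..}) \<and> D \<noteq> 0" if "0 \<le> x" for x
  proof -
    have "gnl_at V lam r j (R x)" "(R has_vector_derivative r j (R x)) (at x within {0..})"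
      "R ` {0..} \<subseteq> V"
      using R that by (auto simp: rarefaction_curve_def)
    then obtain D where D: "(lam j has_derivative D) (at (R x) within V)" "D (r j (R x)) \<noteq> 0"
      unfolding gnl_at_def by blast
    have "((\<lambda>s. lam j (R s)) has_derivative (\<lambda>h. D (h *\<^sub>R r j (R x)))) (at x within {0..})"
      using has_derivative_in_compose[OF \<open>(R has_vector_derivative r j (R x)) (at x within {0..})\<close>
          [unfolded has_vector_derivative_def] has_derivative_subset[OF D(1) \<open>R ` {0..} \<subseteq> V\<close>]] .
    moreover have "D (h *\<^sub>R r j (R x)) = D (r j (R x)) * h" for h
      using D(1) has_derivative_linear linear_scale by (metis mult.commute real_scaleR_def)
    ultimately have "((\<lambda>s. lam j (R s)) has_real_derivative D (r j (R x))) (at x within {0..})"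
      by (simp add: has_field_derivative_def)
    then have "(?l has_real_derivative e * D (r j (R x))) (at x within {0..})"
      by (rule DERIV_cmult)
    moreover have "e \<noteq> 0" using dec[of 1] by auto
    ultimately show ?thesis using D(2) by auto
  qed
  then obtain D where D: "\<And>x. 0 \<le> x \<Longrightarrow> (?l has_real_derivative D x) (at x within {0..})"
    "\<And>x. 0 \<le> x \<Longrightarrow> D x \<noteq> 0"
    by metis
  have Dat: "(?l has_real_derivative D x) (at x)" if "0 < x" for x
    using D(1)[of x] that at_within_interior[of x "{0..}"] by simp
  have cont: "continuous_on {0..t} ?l"
    by (rule continuous_on_subset[of "{0..}"]) (use D(1) in \<open>auto intro!: DERIV_continuous_on\<close>)
  have "inj_on ?l {0..t}"
  proof (rule linorder_inj_onI)
    fix x y assume xy: "x < y" "x \<in> {0..t}" "y \<in> {0..t}"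
    show "?l x \<noteq> ?l y"
    proof
      assume "?l x = ?l y"
      then have "\<exists>z. x < z \<and> z < y \<and> DERIV ?l z :> 0"
        using xy Dat by (intro Rolle continuous_on_subset[OF cont])
          (auto simp: real_differentiable_def intro: less_le_trans le_less_trans)
      then obtain z where "x < z" "DERIV ?l z :> 0" by blast
      then show False
        using Dat[of z] D(2)[of z] DERIV_unique xy by fastforce
    qed
  qed auto
  show ?thesis
  proof (cases "s = 0")
    case True
    then show ?thesis using dec[of t] st R0 by simp
  next
    case False
    with st have "0 < s" by simp
    then show ?thesis
      using continuous_inj_imp_mono[OF \<open>0 < s\<close> st(2) cont \<open>inj_on ?l {0..t}\<close>] dec[of t] st R0 by auto
  qed
qed

lemma rarefaction_curve_derivative:
  fixes g :: "real^'n \<Rightarrow> 'c::real_normed_vector"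
  assumes R: "rarefaction_curve V lam r j p R" and s: "0 \<le> s" "s \<le> b"
    and g: "(g has_derivative g') (at (R s))"
  shows "((\<lambda>s. g (R s)) has_vector_derivative g' (r j (R s))) (at s within {0..b})"
proof -
  have "(R has_vector_derivative r j (R s)) (at s within {0..})"
    using R s by (simp add: rarefaction_curve_def)
  then have "(R has_derivative (\<lambda>h. h *\<^sub>R r j (R s))) (at s within {0..b})"
    unfolding has_vector_derivative_def by (rule has_derivative_subset) auto
  from has_derivative_compose[OF this g] show ?thesis
    unfolding has_vector_derivative_def
    using has_derivative_linear[OF g] by (simp add: linear_scale)
qed

lemma first_zero:
  fixes F :: "real \<Rightarrow> real"
  assumes F: "continuous_on {0..d} F" "F 0 < 0" "F d = 0" and d: "0 < d"
  obtains b where "0 < b" "b \<le> d" "F b = 0" "\<And>s. 0 \<le> s \<Longrightarrow> s < b \<Longrightarrow> F s < 0"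
proof -
  let ?Z = "{s \<in> {0..d}. F s = 0}"
  have "closed ?Z"
    by (rule continuous_closed_preimage_constant[OF F(1) closed_atLeastAtMost])
  moreover have "bounded ?Z"
    by (rule bounded_subset[OF bounded_closed_interval[of 0 d]]) auto
  ultimately have "compact ?Z"
    by (simp only: compact_eq_bounded_closed)
  moreover have "?Z \<noteq> {}" using F(3) d by auto
  ultimately obtain b where b: "b \<in> ?Z" "\<And>s. s \<in> ?Z \<Longrightarrow> b \<le> s"
    using compact_attains_inf[of ?Z] by blast
  have "F s < 0" if s: "0 \<le> s" "s < b" for s
  proof (rule ccontr)
    assume "\<not> F s < 0"
    moreover have "continuous_on {0..s} F"
      using b(1) s by (intro continuous_on_subset[OF F(1)]) auto
    ultimately obtain x where "0 \<le> x" "x \<le> s" "F x = 0"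
      using IVT'[of F 0 0 s] F(2) s(1) by auto
    then show False using b s by force
  qed
  moreover have "0 < b"
    using b(1) F(2) by (cases "b = 0") auto
  ultimately show ?thesis
    using b(1) by (intro that[of b]) auto
qed

text \<open>Both directions at once: e = 1 for p on the left, e = -1 for p on the right. The factor
  e brings speeds, Lax condition and dissipation into the form they have for p on the left. The
  contradiction is a strict increase of energy between two admissible times, whatever h is.\<close>

lemma rarefaction_not_a_contraction:
  fixes V :: "(real^'n) set" and Df :: "real^'n \<Rightarrow> (real^'n) \<Rightarrow>\<^sub>L (real^'n)"
  assumes frame: "framework V f eta q Deta Df lam r"
    and pw: "p \<in> V" "w \<in> V" "p \<noteq> w" and e: "e = 1 \<or> e = -1"
    and j: "1 \<le> j" "j \<le> CARD('n)" and R: "rarefaction_curve V lam r j p R"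
    and dec: "\<And>s. 0 < s \<Longrightarrow> e * lam j (R s) < e * lam j p"
    and lax: "e * lam j p \<le> e * \<sigma>"
    and RH: "f w - f p = \<sigma> *\<^sub>R (w - p)"
    and diss: "e * (q w - q p - \<sigma> * (eta w - eta p)) \<le> 0"
    and a: "0 < a" and sb: "0 < sb" "R sb \<in> Sigma_a eta Deta a ul ur"
    and lr: "ul = (if e = 1 then p else w)" "ur = (if e = 1 then w else p)"
  shows "\<not> a_contraction V f eta q Deta a ul ur \<sigma>"
proof
  assume contr: "a_contraction V f eta q Deta a ul ur \<sigma>"
  have V: "open V" "convex V" and sc: "strictly_convex_on V eta" and C2: "C2_on V eta"
    and f': "\<And>v. v \<in> V \<Longrightarrow> (f has_derivative blinfun_apply (Df v)) (at v)"
    and eta': "\<And>v. v \<in> V \<Longrightarrow> (eta has_derivative (\<lambda>h. Deta v \<bullet> h)) (at v)"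
    and q': "\<And>v. v \<in> V \<Longrightarrow> (q has_derivative (\<lambda>h. Deta v \<bullet> Df v h)) (at v)"
    and eig: "\<And>v. v \<in> V \<Longrightarrow> Df v (r j v) = lam j v *\<^sub>R r j v"
    using frame j unfolding framework_def by auto
  have R0: "R 0 = p" and RV: "\<And>s. 0 \<le> s \<Longrightarrow> R s \<in> V"
    and Rder: "\<And>s. 0 \<le> s \<Longrightarrow> (R has_vector_derivative r j (R s)) (at s within {0..})"
    and R'cont: "continuous_on {0..} (\<lambda>s. r j (R s))"
    using R by (auto simp: rarefaction_curve_def)
  have Rcont: "continuous_on {0..} R"
    using Rder by (auto intro!: continuous_on_vector_derivative)
  have eta_cont: "continuous_on V eta"
    using eta' has_derivative_continuous continuous_at_imp_continuous_on by blast
  note Deta_cont = C2_on_gradient_continuous[OF C2 eta']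
  \<comment> \<open>Weights on the side of p and on the side of w; the weight a goes to the side
    that holds \<open>ur\<close>.\<close>
  define c c' where "c = (if e = 1 then 1 else a)" and "c' = (if e = 1 then a else 1)"
  have c: "0 < c" "0 < c'" using a by (auto simp: c_def c'_def)
  define \<rho> \<rho>' where "\<rho> v = rel_eta eta Deta v p" and "\<rho>' v = rel_eta eta Deta v w" for v
  have \<rho>_cont: "continuous_on V \<rho>" "continuous_on V \<rho>'"
    unfolding \<rho>_def \<rho>'_def rel_eta_def by (intro continuous_intros eta_cont)+
  have \<rho>_nonneg: "0 \<le> \<rho> v" "0 \<le> \<rho>' v" if "v \<in> V" for v
    unfolding \<rho>_def \<rho>'_def using that pw V eta' by (auto intro!: rel_eta_pos[OF sc])
  \<comment> \<open>Its zeros are the points of \<open>Sigma_a\<close> on R. It is negative at p,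
    where the entropy relative to p vanishes and the one relative to w is positive; up to the first
    zero this sign persists.\<close>
  define F where "F s = c * \<rho> (R s) - c' * \<rho>' (R s)" for s
  have "continuous_on {0..sb} F"
    unfolding F_def
    by (intro continuous_intros continuous_on_compose2[OF \<rho>_cont(1)] continuous_on_compose2[OF \<rho>_cont(2)]
        continuous_on_subset[OF Rcont]) (use RV in auto)
  moreover have "F 0 < 0"
  proof -
    have "0 < \<rho>' p"
      unfolding \<rho>'_def using pw V eta' by (intro rel_eta_pos(2)[OF sc]) auto
    then show ?thesis
      using c by (simp add: F_def R0 \<rho>_def rel_eta_def)
  qed
  moreover have "F sb = 0"
    using sb(2) e lr by (auto simp: F_def Sigma_a_def \<rho>_def \<rho>'_def c_def c'_def)
  ultimately obtain b where b_pos: "0 < b" and F_b: "F b = 0" and neg: "\<And>s. 0 \<le> s \<Longrightarrow> s < b \<Longrightarrow> F s < 0"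
    using first_zero[OF _ _ _ sb(1)] by blast
  define l where "l s = e * lam j (R s)" for s
  have l_dec: "l t < l s" if "0 \<le> s" "s < t" for s t
    unfolding l_def by (rule rarefaction_curve_speed_strict_mono[OF R dec that])
  have "continuous_on {0..} l"
    unfolding l_def
  proof (intro continuous_intros)
    have "continuous (at v within V) (lam j)" if "v \<in> R ` {0..}" for v
      using that R has_derivative_continuous unfolding rarefaction_curve_def gnl_at_def by fastforce
    then have "continuous_on (R ` {0..}) (lam j)"
      using RV unfolding continuous_on_eq_continuous_within
      by (meson continuous_within_subset image_subsetI atLeast_iff)
    then show "continuous_on {0..} (\<lambda>s. lam j (R s))"
      by (rule continuous_on_compose2[OF _ Rcont]) auto
  qed
  then have l_cont: "continuous_on {0..b} l"
    by (rule continuous_on_subset) auto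
  have el: "e * l s = lam j (R s)" for s
    using e by (auto simp: l_def)
  define UK where "UK = convex hull (insert w (R ` {0..b}))"
  have RbV: "R ` {0..b} \<subseteq> V" using RV by auto
  have "UK \<subseteq> Ucl V eta"
    using hull_minimal[of "insert w (R ` {0..b})" V convex] RbV pw(2) V(2) subset_Ucl[of V eta]
    unfolding UK_def by blast
  moreover have "bounded UK"
    unfolding UK_def
    by (intro bounded_convex_hull compact_imp_bounded compact_insert compact_continuous_image
        continuous_on_subset[OF Rcont]) auto
  moreover have "convex UK"
    by (simp add: UK_def)
  ultimately have "\<exists>C>0. \<forall>T>0. \<forall>u u0.
          (\<forall>z\<in>strip T. u z \<in> UK) \<and> BV_loc (strip T) u \<and>
          entropy_solution f eta q T u u0 \<and> E_a eta Deta a ul ur u0 0 < \<infinity> \<longrightarrow>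
          (\<exists>h::real \<Rightarrow> real. h 0 = 0 \<and> C-lipschitz_on {0..<T} h \<and>
             (\<exists>N. N \<in> null_sets lborel \<and>
                (\<forall>s t. s \<notin> N \<and> t \<notin> N \<and> 0 < s \<and> s < t \<and> t < T \<longrightarrow>
                   E_a eta Deta a ul ur (\<lambda>x. u (t, x)) (h t)
                     \<le> E_a eta Deta a ul ur (\<lambda>x. u (s, x)) (h s))) \<and>
             (\<forall>t\<in>{0..<T}. ennreal ((h t - \<sigma> * t)\<^sup>2)
                  \<le> ennreal (C\<^sup>2 * t) * L2sq u0 (riemann_step ul ur)))"
    (is "\<exists>C>0. ?P C")
    by (intro contr[unfolded a_contraction_def, rule_format] conjI)
  then obtain C where C: "C > 0" and sol: "?P C" by blast
  \<comment> \<open>The Lipschitz constant supplied by the contraction becomes the half-width of the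
    plateau.\<close>
  interpret fan_shock b R l e \<sigma> C w
  proof
    show "continuous_on {0..b} R" by (rule continuous_on_subset[OF Rcont]) auto
    show "l 0 \<le> e * \<sigma>" using lax by (simp add: l_def R0)
  qed (use b_pos l_cont l_dec e C in auto)
  have Rb: "(R has_vector_derivative r j (R s)) (at s within {0..b})" if "0 \<le> s" "s \<le> b" for s
    by (rule has_vector_derivative_within_subset[OF Rder]) (use that in auto)
  have R'b: "continuous_on {0..b} (\<lambda>s. r j (R s))"
    by (rule continuous_on_subset[OF R'cont]) auto
  have fR: "((\<lambda>s. f (R s)) has_vector_derivative (e * l s) *\<^sub>R r j (R s)) (at s within {0..b})"
    if "0 \<le> s" "s \<le> b" for s
    using rarefaction_curve_derivative[OF R that f'[OF RV]] that by (simp add: el eig RV)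
  have etaR: "((\<lambda>s. eta (R s)) has_vector_derivative Deta (R s) \<bullet> r j (R s)) (at s within {0..b})"
    if "0 \<le> s" "s \<le> b" for s
    using rarefaction_curve_derivative[OF R that eta'[OF RV]] that by simp
  have qR: "((\<lambda>s. q (R s)) has_vector_derivative (e * l s) * (Deta (R s) \<bullet> r j (R s))) (at s within {0..b})"
    if "0 \<le> s" "s \<le> b" for s
    using rarefaction_curve_derivative[OF R that q'[OF RV]] that by (simp add: el eig RV)
  have \<gamma>: "continuous_on {0..b} (\<lambda>s. Deta (R s) \<bullet> r j (R s))"
    by (intro continuous_intros R'b continuous_on_compose2[OF Deta_cont] continuous_on_subset[OF Rcont])
       (use RV in auto)
  have es: "entropy_solution f eta q 1 u (\<lambda>x. u (0, x))"
    unfolding entropy_solution_def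
  proof (intro conjI allI impI; (elim conjE)?)
    show "weak_solution f 1 u (\<lambda>x. u (0, x))"
      using u_weak_solution[OF Rb R'b fR] RH R0 by simp
    fix \<phi> :: "real \<times> real \<Rightarrow> real"
    assume \<phi>: "C1c \<phi>" "tsupp \<phi> \<subseteq> strip 1" "\<forall>z. 0 \<le> \<phi> z"
    note ineq = u_entropy_inequality[of eta _ q, OF etaR qR \<gamma>, unfolded R0, OF _ _ _ _ diss \<phi>(1,2) \<phi>(3)[rule_format]]
    show "integrable lborel (\<lambda>z. indicator (strip 1) z * (dt \<phi> z * eta (u z) + dx \<phi> z * q (u z)))"
      "0 \<le> (\<integral>z. indicator (strip 1) z * (dt \<phi> z * eta (u z) + dx \<phi> z * q (u z)) \<partial>lborel)"
      using ineq by auto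
  qed
  have bv: "BV_loc (strip 1) u"
    by (rule u_BV_loc[OF Rb R'b])
  have inUK: "\<forall>z\<in>strip 1. u z \<in> UK"
    using u_in hull_subset[of "insert w (R ` {0..b})" convex] unfolding UK_def by blast
  have meas [measurable]: "(\<lambda>x. \<rho> (u (t, x))) \<in> borel_measurable borel" "(\<lambda>x. \<rho>' (u (t, x))) \<in> borel_measurable borel" for t
    by (rule measurable_compose[OF _ u_observable_measurable];
        auto intro!: borel_measurable_continuous_onI continuous_intros continuous_on_subset[OF \<rho>_cont(1) RbV]
          continuous_on_subset[OF \<rho>_cont(2) RbV])+
  \<comment> \<open>For e = -1 the reflection x = - y exchanges the half-lines together with their
    weights, so the side of p is always y \<le> e h.\<close>
  have E: "E_a eta Deta a ul ur (\<lambda>x. u (t, x)) h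
    = ennreal c * (\<integral>\<^sup>+y. indicator {..e * h} y * ennreal (\<rho> (u (t, e * y))) \<partial>lborel)
      + ennreal c' * (\<integral>\<^sup>+y. indicator {e * h..} y * ennreal (\<rho>' (u (t, e * y))) \<partial>lborel)" for t h
  proof (cases "e = 1")
    case True
    then show ?thesis
      by (simp add: E_a_def lr c_def c'_def \<rho>_def \<rho>'_def)
  next
    case False
    then have e1: "e = -1" using e by simp
    have "(\<integral>\<^sup>+x. indicator {..h} x * ennreal (\<rho>' (u (t, x))) \<partial>lborel)
      = (\<integral>\<^sup>+y. indicator {..h} (- y) * ennreal (\<rho>' (u (t, - y))) \<partial>lborel)"
      using nn_integral_real_affine[of "\<lambda>x. indicator {..h} x * ennreal (\<rho>' (u (t, x)))" "-1" 0] by simp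
    moreover have "(\<integral>\<^sup>+x. indicator {h..} x * ennreal (\<rho> (u (t, x))) \<partial>lborel)
      = (\<integral>\<^sup>+y. indicator {h..} (- y) * ennreal (\<rho> (u (t, - y))) \<partial>lborel)"
      using nn_integral_real_affine[of "\<lambda>x. indicator {h..} x * ennreal (\<rho> (u (t, x)))" "-1" 0] by simp
    moreover have "indicator {..h} (- y) = (indicator {- h..} y :: ennreal)"
      "indicator {h..} (- y) = (indicator {..- h} y :: ennreal)" for y
      by (auto simp: indicator_def)
    ultimately show ?thesis
      using False e1 by (simp add: E_a_def lr c_def c'_def \<rho>_def \<rho>'_def add.commute)
  qed
  obtain K G where KG: "0 \<le> K" "0 < G" and energy: "\<And>t h. 0 \<le> t \<Longrightarrow> t \<le> 1 \<Longrightarrow> \<bar>h\<bar> \<le> C \<Longrightarrow>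
      ennreal c * (\<integral>\<^sup>+y. indicator {..h} y * ennreal (\<rho> (u (t, e * y))) \<partial>lborel)
      + ennreal c' * (\<integral>\<^sup>+y. indicator {h..} y * ennreal (\<rho>' (u (t, e * y))) \<partial>lborel) = ennreal (K + t * G)"
  proof (rule energy_affine[of \<rho> \<rho>' c c'])
    show "continuous_on (R ` {0..b}) \<rho>" "continuous_on (R ` {0..b}) \<rho>'"
      using \<rho>_cont RbV continuous_on_subset by blast+
    show "\<rho> (R 0) = 0" "\<rho>' w = 0"
      by (simp_all add: \<rho>_def \<rho>'_def rel_eta_def R0)
    show "c * \<rho> (R b) = c' * \<rho>' (R b)" using F_b by (simp add: F_def)
    show "c * \<rho> (R s) < c' * \<rho>' (R s)" if "0 \<le> s" "s < b" for s
      using neg[OF that] by (simp add: F_def)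
  qed (use \<rho>_nonneg RbV c in auto)
  have Eval: "E_a eta Deta a ul ur (\<lambda>x. u (t, x)) h = ennreal (K + t * G)"
    if "0 \<le> t" "t \<le> 1" "\<bar>h\<bar> \<le> C" for t h
    unfolding E using that e by (intro energy) auto
  have "E_a eta Deta a ul ur (\<lambda>x. u (0, x)) 0 < \<infinity>"
    using Eval[of 0 0] C by simp
  then obtain h N where h: "h 0 = 0" "C-lipschitz_on {0..<1} h" and N: "N \<in> null_sets lborel"
    and mono: "\<And>s t. s \<notin> N \<Longrightarrow> t \<notin> N \<Longrightarrow> 0 < s \<Longrightarrow> s < t \<Longrightarrow> t < 1 \<Longrightarrow>
       E_a eta Deta a ul ur (\<lambda>x. u (t, x)) (h t) \<le> E_a eta Deta a ul ur (\<lambda>x. u (s, x)) (h s)"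
    using sol[rule_format, of 1 u "\<lambda>x. u (0, x)"] inUK bv es by auto
  \<comment> \<open>The horizon 1 is what makes the Lipschitz constant itself a bound for the
    shift.\<close>
  have hC: "\<bar>h t\<bar> \<le> C" if "0 \<le> t" "t < 1" for t
  proof -
    have "dist (h t) (h 0) \<le> C * dist t 0"
      using that by (intro lipschitz_onD[OF h(2)]) auto
    also have "\<dots> \<le> C * 1"
      using that C by (intro mult_left_mono) auto
    finally show ?thesis using h(1) by simp
  qed
  \<comment> \<open>A nonempty open interval is not a null set, so admissible times exist on either
    side of 1/2.\<close>
  have pick: "\<exists>s. s \<notin> N \<and> x < s \<and> s < y" if "x < y" for x y
  proof (rule ccontr)
    assume "\<not> ?thesis"
    then have "{x<..<y} \<subseteq> N" by auto
    then have "{x<..<y} \<in> null_sets lborel"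
      using N by (rule null_sets_subset[rotated 2]) simp
    then show False using that by (simp add: null_sets_def)
  qed
  obtain s where s: "s \<notin> N" "0 < s" "s < 1/2" using pick[of 0 "1/2"] by auto
  obtain t where t: "t \<notin> N" "1/2 < t" "t < 1" using pick[of "1/2" 1] by auto
  have "ennreal (K + t * G) \<le> ennreal (K + s * G)"
    using mono[OF s(1) t(1)] s t Eval[OF _ _ hC, of t t] Eval[OF _ _ hC, of s s] by simp
  moreover have "0 \<le> K + s * G"
    using KG s by simp
  ultimately have "K + t * G \<le> K + s * G"
    by (simp only: ennreal_le_iff)
  then show False using KG(2) s t by simp
qed

theorem theorem5p1:
  fixes V :: "(real^'n) set" and f :: "real^'n \<Rightarrow> real^'n" and eta q :: "real^'n \<Rightarrow> real"
    and Deta :: "real^'n \<Rightarrow> real^'n" and Df :: "real^'n \<Rightarrow> (real^'n) \<Rightarrow>\<^sub>L (real^'n)"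
    and lam :: "nat \<Rightarrow> real^'n \<Rightarrow> real" and r :: "nat \<Rightarrow> real^'n \<Rightarrow> real^'n"
    and i :: nat and ul ur :: "real^'n" and \<sigma>lr s0 a :: real
    and S :: "real \<Rightarrow> real^'n" and sig :: "real \<Rightarrow> real" and su :: ereal
  assumes frame: "framework V f eta q Deta Df lam r"
    and A1: "hypA1 V f eta q lam r i ul S sig su"
    and s0: "0 < s0" "ereal s0 < su"
    and ur: "ur = S s0" and slr: "\<sigma>lr = sig s0"
    and ur_V: "ur \<in> V"
    and shock: "mth_shock f eta q lam i ul ur \<sigma>lr"
  shows "(0 < a \<and> a < 1 \<and>
            (\<exists>j R sb. 1 \<le> j \<and> j < i \<and> backward_rarefaction V lam r j ul R \<and>
                       0 < sb \<and> R sb \<in> Sigma_a eta Deta a ul ur)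
           \<longrightarrow> \<not> a_contraction V f eta q Deta a ul ur \<sigma>lr)
       \<and> (1 < a \<and>
            (\<exists>k R sb. i < k \<and> k \<le> CARD('n) \<and> forward_rarefaction V lam r k ur R \<and>
                       0 < sb \<and> R sb \<in> Sigma_a eta Deta a ul ur)
           \<longrightarrow> \<not> a_contraction V f eta q Deta a ul ur \<sigma>lr)
       \<and> (a = 1 \<and>
            ((\<exists>j R sb. 1 \<le> j \<and> j < i \<and> backward_rarefaction V lam r j ul R \<and>
                       0 < sb \<and> R sb \<in> Sigma_a eta Deta a ul ur)
             \<or> (\<exists>k R sb. i < k \<and> k \<le> CARD('n) \<and> forward_rarefaction V lam r k ur R \<and>
                       0 < sb \<and> R sb \<in> Sigma_a eta Deta a ul ur))
           \<longrightarrow> \<not> a_contraction V f eta q Deta a ul ur \<sigma>lr)"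
proof -
  have i: "1 < i" "i < CARD('n)" and ul_V: "ul \<in> V"
    and Lax: "\<And>m um up \<sigma>. 1 \<le> m \<and> m \<le> CARD('n) \<and> um \<in> Ucl V eta \<and> up \<in> Ucl V eta \<and>
        mth_shock f eta q lam m um up \<sigma> \<Longrightarrow>
        (2 \<le> m \<longrightarrow> lam (m - 1) um \<le> \<sigma>) \<and> (m + 1 \<le> CARD('n) \<longrightarrow> \<sigma> \<le> lam (m + 1) up)"
    using A1 unfolding hypA1_def by blast+
  \<comment> \<open>The extended Lax condition for m = i; since 1 < i < n, both neighbouring fields
    exist.\<close>
  have lax: "lam (i - 1) ul \<le> \<sigma>lr" "\<sigma>lr \<le> lam (i + 1) ur"
    using Lax[of i ul ur \<sigma>lr] i ul_V ur_V shock subset_Ucl[of V eta] by auto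
  have disc: "ul \<noteq> ur" "f ur - f ul = \<sigma>lr *\<^sub>R (ur - ul)" "q ur - q ul \<le> \<sigma>lr * (eta ur - eta ul)"
    using shock unfolding mth_shock_def entropic_disc_def by auto
  have lam_mono: "lam m v \<le> lam n v" if "v \<in> V" "1 \<le> m" "m \<le> n" "n \<le> CARD('n)" for m n v
    using that(3,4)
  proof (induction n rule: dec_induct)
    case (step n)
    have "lam n v \<le> lam (Suc n) v"
      using frame that(1,2) step unfolding framework_def by auto
    with step show ?case by simp
  qed simp
  have backward: "\<not> a_contraction V f eta q Deta a ul ur \<sigma>lr"
    if "0 < a" "1 \<le> j" "j < i" "backward_rarefaction V lam r j ul R" "0 < sb" "R sb \<in> Sigma_a eta Deta a ul ur"
    for j R sb
  proof (rule rarefaction_not_a_contraction[OF frame ul_V ur_V disc(1), of 1 j R])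
    \<comment> \<open>From j \<le> i - 1, the ordering of the eigenvalues at \<open>ul\<close>
      carries the Lax bound for field i - 1 over to field j.\<close>
    have "lam j ul \<le> lam (i - 1) ul"
      using that i by (intro lam_mono ul_V) auto
    then show "1 * lam j ul \<le> 1 * \<sigma>lr" using lax by simp
  qed (use that i disc in \<open>auto simp: backward_rarefaction_def\<close>)
  have forward: "\<not> a_contraction V f eta q Deta a ul ur \<sigma>lr"
    if "0 < a" "i < k" "k \<le> CARD('n)" "forward_rarefaction V lam r k ur R" "0 < sb" "R sb \<in> Sigma_a eta Deta a ul ur"
    for k R sb
  proof (rule rarefaction_not_a_contraction[OF frame ur_V ul_V disc(1)[symmetric], of "-1" k R])
    have "lam (i + 1) ur \<le> lam k ur"
      using that i by (intro lam_mono ur_V) auto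
    then show "- 1 * lam k ur \<le> - 1 * \<sigma>lr" using lax by simp
    \<comment> \<open>Exchanging the end states changes the sign of both sides of the
      Rankine-Hugoniot relation; in the entropy inequality the factor e = -1 compensates the
      change.\<close>
    have "f ul - f ur = - (f ur - f ul)" by simp
    also have "\<dots> = \<sigma>lr *\<^sub>R (ul - ur)"
      unfolding disc(2) by (simp add: algebra_simps)
    finally show "f ul - f ur = \<sigma>lr *\<^sub>R (ul - ur)" .
    show "- 1 * (q ul - q ur - \<sigma>lr * (eta ul - eta ur)) \<le> 0"
      using disc(3) by (simp add: algebra_simps)
  qed (use that i in \<open>auto simp: forward_rarefaction_def\<close>)
  show ?thesis
    using backward forward by (metis less_trans zero_less_one)
qed

end
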